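(* The second order differential equation $$v_z+4\,\frac{v_{zz}-v_z}{\big(1-b(v_{zz}-v_z)\big)^2}=0\qquad(\ast)$$ is exactly integrable for an arbitrary value of the parameter $b$. For $b\neq0$ the complete set of solutions is given by the union of the following solutions, where $d\in\mathbb{R}$ is an arbitrary constant. (a) $v(z)=d$, $\quad v(z)=-\frac3b z+d$, $\quad v(z)=\frac1b z+d$. (b) For $c>0$, with $\tau=2+c\,e^{3z/2}+\sqrt{4c\,e^{3z/2}+c^2e^{3z}}$, $$v(z)=-\frac{2^{2/3}}{b\,\tau^{2/3}}-\frac{\tau^{2/3}}{b\,2^{2/3}}-\frac2b\log\!\Big(\frac{2^{1/3}}{\tau^{1/3}}+\frac{\tau^{1/3}}{2^{1/3}}-2\Big)+d.$$ (c) For $c<0$, with $\alpha=\arccos\!\big(1-\frac{|c|}{2}e^{3z/2}\big)$ and $\beta=\arccos\!\big(-1+\frac{|c|}{2}e^{3z/2}\big)$, the two solutions $$v_1(z)=\frac zb-\frac2b\cos\!\Big(\frac23\alpha\Big)-\frac{4}{3b}\log\!\Big(1+2\cos\!\Big(\frac13\alpha\Big)\Big)-\frac{16}{3b}\log\!\Big(\sin\!\Big(\frac16\alpha\Big)\Big)+d,$$ $$v_2(z)=\frac zb-\frac2b\cos\!\Big(\frac{2}3\pi+\frac23\beta\Big)-\frac{4}{3b}\log\!\Big(1+2\cos\!\Big(\frac13\pi+\frac13\beta\Big)\Big)-\frac{16}{3b}\log\!\Big(\sin\!\Big(\frac16\pi+\frac16\beta\Big)\Big)+d,$$ which are defined up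 to the point $z=\frac43\ln\frac{2}{|c|}$, where they coincide. (d) For $c<0$, a third solution, given for $z<\frac43\ln\frac2{|c|}$, with $\beta$ as in (c), by $$v_{3,1}(z)=\frac zb-\frac2b\cos\!\Big(\frac23\beta\Big)-\frac{4}{3b}\log\!\Big(-1+2\cos\!\Big(\frac13\beta\Big)\Big)-\frac{16}{3b}\log\!\Big(\cos\!\Big(\frac16\beta\Big)\Big)+d,$$ and for $z>\frac43\ln\frac2{|c|}$, with $\gamma=\operatorname{arccosh}\!\big(-1+\frac{|c|}{2}e^{3z/2}\big)$, by $$v_{3,2}(z)=\frac zb-\frac2b\cosh\!\Big(\frac23\gamma\Big)-\frac{16}{3b}\log\!\Big(\cosh\!\Big(\frac16\gamma\Big)\Big)-\frac{4}{3b}\log\!\Big(-1+2\cosh\!\Big(\frac13\gamma\Big)\Big)+d.$$ The last solution in (a), $v(z)=\frac1bz+d$, corresponds (via $y=v_z$) to the exceptional solution $y=\frac1b$ of the equation $$F(y,y_z):=y\,y_z^2-2\Big(y^2+\frac1by-\frac{2}{b^2}\Big)y_z+\Big(y^2+\frac2by-\frac{3}{b^2}\Big)y=0.$$ For $b=0$ equation $(\ast)$ is linear and its solutions are given by $v(z)=d_1+d_2e^{3z/4}$, where $d_1,d_2$ are arbitrary constants.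
   Context: Here $v=v(z)$ is the unknown function of a real variable $z$, subscripts denote derivatives in $z$, and it is assumed that the denominator $1-b(v_{zz}-v_z)$ in $(\ast)$ is not equal to zero. The equation $F(y,y_z)=0$ is obtained from $(\ast)$ (for $b\neq0$) by setting $y=v_z$ and multiplying by the denominator; an exceptional solution of it is a solution of the system $F(y,y_z)=0$, $\frac{\partial F}{\partial y_z}(y,y_z)=0$.
   Formalization: The point (4/3)ln(2/|c|) is corrected to (4/3)ln(2/√|c|). Completeness holds for three times differentiable solutions; twice differentiable ones, which may glue v_2 to z/b+d, are listed off finitely many points where v_z=1/b. *)

theory Defs
  imports "HOL-Analysis.Analysis"
begin

definition ode_lhs :: "real \<Rightarrow> real \<Rightarrow> real \<Rightarrow> real" where
  "ode_lhs b p q = p + 4 * ((q - p) / (1 - b * (q - p))\<^sup>2)"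

definition open_interval :: "real set \<Rightarrow> bool" where
  "open_interval I \<longleftrightarrow> open I \<and> is_interval I"

text \<open>Used only for open \<open>I\<close>, so that \<^const>\<open>deriv\<close> depends only on the values of \<open>v\<close> on \<open>I\<close>.\<close>

definition solves_ode2 :: "real \<Rightarrow> real set \<Rightarrow> (real \<Rightarrow> real) \<Rightarrow> bool" where
  "solves_ode2 b I v \<longleftrightarrow>
     (\<forall>z\<in>I. v differentiable (at z) \<and> deriv v differentiable (at z) \<and>
        1 - b * (deriv (deriv v) z - deriv v z) \<noteq> 0 \<and>
        ode_lhs b (deriv v z) (deriv (deriv v) z) = 0)"

definition tau :: "real \<Rightarrow> real \<Rightarrow> real" where
  "tau c z = 2 + c * exp (3 * z / 2) + sqrt (4 * c * exp (3 * z / 2) + c\<^sup>2 * exp (3 * z))"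

definition alpha :: "real \<Rightarrow> real \<Rightarrow> real" where
  "alpha c z = arccos (1 - \<bar>c\<bar> / 2 * exp (3 * z / 2))"

definition beta :: "real \<Rightarrow> real \<Rightarrow> real" where
  "beta c z = arccos (- 1 + \<bar>c\<bar> / 2 * exp (3 * z / 2))"

definition gamma :: "real \<Rightarrow> real \<Rightarrow> real" where
  "gamma c z = arcosh (- 1 + \<bar>c\<bar> / 2 * exp (3 * z / 2))"

text \<open>
  The point where the arguments of the inverse functions above reach \<open>-1\<close> and \<open>1\<close>, that is,
  \<open>\<bar>c\<bar> exp (3 z / 2) = 4\<close>. The expression \<open>4/3 ln (2 / \<bar>c\<bar>)\<close>, without the square root,
  agrees with it only for \<open>\<bar>c\<bar> = 1\<close>.
\<close>

definition z_crit :: "real \<Rightarrow> real" where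
  "z_crit c = 4 / 3 * ln (2 / sqrt \<bar>c\<bar>)"

definition v_b :: "real \<Rightarrow> real \<Rightarrow> real \<Rightarrow> real \<Rightarrow> real" where
  "v_b b c d z =
     - (2 powr (2/3) / (b * tau c z powr (2/3))) - tau c z powr (2/3) / (b * 2 powr (2/3))
     - 2 / b * ln (2 powr (1/3) / tau c z powr (1/3) + tau c z powr (1/3) / 2 powr (1/3) - 2) + d"

definition v_1 :: "real \<Rightarrow> real \<Rightarrow> real \<Rightarrow> real \<Rightarrow> real" where
  "v_1 b c d z =
     z / b - 2 / b * cos (2/3 * alpha c z)
     - 4 / (3 * b) * ln (1 + 2 * cos (1/3 * alpha c z))
     - 16 / (3 * b) * ln (sin (1/6 * alpha c z)) + d"

definition v_2 :: "real \<Rightarrow> real \<Rightarrow> real \<Rightarrow> real \<Rightarrow> real" where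
  "v_2 b c d z =
     z / b - 2 / b * cos (2/3 * pi + 2/3 * beta c z)
     - 4 / (3 * b) * ln (1 + 2 * cos (1/3 * pi + 1/3 * beta c z))
     - 16 / (3 * b) * ln (sin (1/6 * pi + 1/6 * beta c z)) + d"

definition v_31 :: "real \<Rightarrow> real \<Rightarrow> real \<Rightarrow> real \<Rightarrow> real" where
  "v_31 b c d z =
     z / b - 2 / b * cos (2/3 * beta c z)
     - 4 / (3 * b) * ln (- 1 + 2 * cos (1/3 * beta c z))
     - 16 / (3 * b) * ln (cos (1/6 * beta c z)) + d"

definition v_32 :: "real \<Rightarrow> real \<Rightarrow> real \<Rightarrow> real \<Rightarrow> real" where
  "v_32 b c d z =
     z / b - 2 / b * cosh (2/3 * gamma c z)
     - 16 / (3 * b) * ln (cosh (1/6 * gamma c z))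
     - 4 / (3 * b) * ln (- 1 + 2 * cosh (1/3 * gamma c z)) + d"

text \<open>The third solution passes through \<open>z_crit c\<close>, where both expressions have the same value.\<close>

definition v_3 :: "real \<Rightarrow> real \<Rightarrow> real \<Rightarrow> real \<Rightarrow> real" where
  "v_3 b c d z = (if z \<le> z_crit c then v_31 b c d z else v_32 b c d z)"

text \<open>
  Since \<^const>\<open>sqrt\<close>, \<^const>\<open>ln\<close>, \<^const>\<open>arccos\<close> and \<^const>\<open>arcosh\<close> are total in HOL, the sets of
  real \<open>z\<close> at which the formulas are meaningful are recorded separately.
\<close>

definition dom_b :: "real \<Rightarrow> real set" where
  "dom_b c = {z. 0 \<le> 4 * c * exp (3 * z / 2) + c\<^sup>2 * exp (3 * z) \<and> 0 < tau c z \<and>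
     0 < 2 powr (1/3) / tau c z powr (1/3) + tau c z powr (1/3) / 2 powr (1/3) - 2}"

definition dom_1 :: "real \<Rightarrow> real set" where
  "dom_1 c = {z. 1 - \<bar>c\<bar> / 2 * exp (3 * z / 2) \<in> {-1..1} \<and>
     0 < 1 + 2 * cos (1/3 * alpha c z) \<and> 0 < sin (1/6 * alpha c z)}"

definition dom_2 :: "real \<Rightarrow> real set" where
  "dom_2 c = {z. - 1 + \<bar>c\<bar> / 2 * exp (3 * z / 2) \<in> {-1..1} \<and>
     0 < 1 + 2 * cos (1/3 * pi + 1/3 * beta c z) \<and> 0 < sin (1/6 * pi + 1/6 * beta c z)}"

definition dom_31 :: "real \<Rightarrow> real set" where
  "dom_31 c = {z. - 1 + \<bar>c\<bar> / 2 * exp (3 * z / 2) \<in> {-1..1} \<and>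
     0 < - 1 + 2 * cos (1/3 * beta c z) \<and> 0 < cos (1/6 * beta c z)}"

definition dom_32 :: "real \<Rightarrow> real set" where
  "dom_32 c = {z. 1 \<le> - 1 + \<bar>c\<bar> / 2 * exp (3 * z / 2) \<and>
     0 < cosh (1/6 * gamma c z) \<and> 0 < - 1 + 2 * cosh (1/3 * gamma c z)}"

text \<open>
  The listed solutions, each with its maximal interval. The point \<open>z_crit c\<close> is excluded for
  \<^const>\<open>v_1\<close> and \<^const>\<open>v_2\<close>, whose second derivatives are unbounded there.
\<close>

definition solution_family :: "real \<Rightarrow> (real set \<times> (real \<Rightarrow> real)) set" where
  "solution_family b =
     {(UNIV, \<lambda>z. d) | d. True} \<union>
     {(UNIV, \<lambda>z. - (3 / b) * z + d) | d. True} \<union>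
     {(UNIV, \<lambda>z. 1 / b * z + d) | d. True} \<union>
     {(UNIV, v_b b c d) | c d. c > 0} \<union>
     {({..< z_crit c}, v_1 b c d) | c d. c < 0} \<union>
     {({..< z_crit c}, v_2 b c d) | c d. c < 0} \<union>
     {(UNIV, v_3 b c d) | c d. c < 0}"

text \<open>
  At \<open>\<bar>c\<bar> exp (3 z / 2) = 2\<close> the solution \<^const>\<open>v_2\<close> has second-order contact with a line
  \<open>z / b + d\<close>. A twice differentiable solution can therefore consist of an arc of \<^const>\<open>v_2\<close>,
  a segment of the line and an arc of another \<^const>\<open>v_2\<close>, without being the restriction of a
  single member of the family; such a solution is not three times differentiable.
\<close>

definition listed_on :: "real \<Rightarrow> real set \<Rightarrow> (real \<Rightarrow> real) \<Rightarrow> bool" where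
  "listed_on b I v \<longleftrightarrow> (\<exists>(J, f) \<in> solution_family b. I \<subseteq> J \<and> (\<forall>z\<in>I. v z = f z))"

definition F :: "real \<Rightarrow> real \<Rightarrow> real \<Rightarrow> real" where
  "F b y p = y * p\<^sup>2 - 2 * (y\<^sup>2 + 1 / b * y - 2 / b\<^sup>2) * p + (y\<^sup>2 + 2 / b * y - 3 / b\<^sup>2) * y"

definition exceptional_solution :: "real \<Rightarrow> real set \<Rightarrow> (real \<Rightarrow> real) \<Rightarrow> bool" where
  "exceptional_solution b I y \<longleftrightarrow>
     (\<forall>z\<in>I. y differentiable (at z) \<and> F b (y z) (deriv y z) = 0 \<and>
        deriv (\<lambda>p. F b (y z) p) (deriv y z) = 0)"

end

theory Submission
  imports Defs
begin

text \<open>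
  Put \<open>u = b v'\<close> and \<open>s = 1 - b (v'' - v')\<close>. The equation reads \<open>u s\<^sup>2 + 4 (1 - s) = 0\<close>, a rational
  curve, parametrized by \<open>q = 2 / s - 1 \<noteq> - 1\<close> as \<open>u = 1 - q\<^sup>2\<close>, \<open>s = 2 / (q + 1)\<close>. Differentiating,
  either \<open>q = 0\<close> (the exceptional solution) or \<open>q' = (q - 1) (q + 2) / (2 (q + 1))\<close>. The latter has the
  first integral \<open>(q\<^sup>3 - 3 q + 2) exp (- 3 z / 2)\<close>, and along it \<open>- q\<^sup>2 - ln ((q + 2)\<^sup>2)\<close> is a primitive of
  \<open>u\<close>. The trigonometric and hyperbolic formulas are Cardano's solutions of
  \<open>q\<^sup>3 - 3 q + 2 = C exp (3 z / 2)\<close>; \<open>q\<close> cannot leave a branch through \<open>1\<close> (an equilibrium) or \<open>- 1\<close>.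
  A zero of \<open>q\<close> is crossed downwards, so the zeros form an interval, and gluing can only occur at its
  ends; there \<open>q\<close> would have one-sided slopes \<open>0\<close> and \<open>- 1\<close>, which a third derivative of \<open>v\<close> rules out.
\<close>

section \<open>The parametrized equation\<close>

text \<open>Divided by \<open>s^2\<close>, the equation is quadratic in \<open>1 / s\<close>, and
  completing the square gives \<open>u = 1 - (2 / s - 1)^2\<close>; this is the origin of
  \<open>q\<close>. It is read off from the denominator and not chosen as a square root of
  \<open>1 - u\<close>, so \<open>v\<close> itself decides its sign. Since
  \<open>b v'' = - 2 q flow q\<close> contains the factor \<open>q\<close>, a corner of
  \<open>q\<close> at one of its zeros leaves \<open>v''\<close> intact and shows only in the third
  derivative: hence two classifications, one away from finitely many points and one for three times
  differentiable solutions. The critical points 1 and - 1 of the cubic are a zero and the pole of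
  \<open>flow\<close>, so the branches that a trajectory cannot leave are the very ones on which the
  cubic determines \<open>q\<close>. The explicit formulas are never differentiated: a continuous
  root of the cubic follows the flow automatically, and a single primitive serves all branches. In
  terms of the listed families, \<open>C\<close> is \<open>- c\<close> for either sign of
  \<open>c\<close>.\<close>

definition flow :: "real \<Rightarrow> real" where
  "flow q = (q - 1) * (q + 2) / (2 * (q + 1))"

definition cubic :: "real \<Rightarrow> real" where
  "cubic q = q ^ 3 - 3 * q + 2"

text \<open>Obtained by integrating \<open>(1 - q^2) / flow q = - 2 (q + 1)^2 / (q + 2)\<close> over
  \<open>q\<close>. The logarithm of a square covers \<open>q < - 2\<close>, where
  \<open>q_b\<close> lives, and \<open>q > - 2\<close> by one formula.\<close>

definition potential :: "real \<Rightarrow> real" where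
  "potential q = - q\<^sup>2 - ln ((q + 2)\<^sup>2)"

lemma cubic_factor: "cubic q = (q - 1)\<^sup>2 * (q + 2)"
  by (simp add: cubic_def power2_eq_square power3_eq_cube algebra_simps)

lemma DERIV_cubic: "(cubic has_real_derivative 3 * (q\<^sup>2 - 1)) (at q)"
  unfolding cubic_def [abs_def] by (auto intro!: derivative_eq_intros simp: algebra_simps)

lemma DERIV_potential:
  assumes "(q has_real_derivative q') (at z)" "q z \<noteq> -2"
  shows "((\<lambda>z. potential (q z)) has_real_derivative - 2 * (q z + 1)\<^sup>2 / (q z + 2) * q') (at z)"
proof -
  have "((\<lambda>z. potential (q z)) has_real_derivative
      - (2 * q z * q') - 2 * (q z + 2) * q' / (q z + 2)\<^sup>2) (at z)"
    unfolding potential_def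
    using assms by (auto intro!: derivative_eq_intros)
  moreover have "- (2 * q z * q') - 2 * (q z + 2) * q' / (q z + 2)\<^sup>2 =
      - 2 * (q z + 1)\<^sup>2 / (q z + 2) * q'"
  proof -
    have "q z + 2 \<noteq> 0" using assms(2) by simp
    then show ?thesis by (simp add: divide_simps power2_eq_square) algebra
  qed
  ultimately show ?thesis by simp
qed

text \<open>Solving the relation for \<open>z\<close> gives
  \<open>z = 2/3 ln (cubic (q z) / C)\<close>, an explicit left inverse of \<open>q\<close>, so
  continuity of \<open>q\<close> suffices for the inverse function rule. \<open>C \<noteq> 0\<close>
  keeps \<open>q\<close> off 1 and - 2, and \<open>q z \<noteq> -1\<close> keeps the derivative of
  the left inverse from vanishing.\<close>

lemma cubic_root_DERIV:
  assumes "open I" "continuous_on I q" "C \<noteq> 0" "z \<in> I"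
    and root: "\<And>z. z \<in> I \<Longrightarrow> cubic (q z) = C * exp (3 * z / 2)"
    and "q z \<noteq> -1"
  shows "(q has_real_derivative flow (q z)) (at z)"
proof -
  obtain e where e: "e > 0" "\<And>w. \<bar>w - z\<bar> < e \<Longrightarrow> w \<in> I"
    using \<open>open I\<close> \<open>z \<in> I\<close> by (metis open_real)
  define f where "f y = 2 / 3 * ln (cubic y / C)" for y
  have nz: "cubic (q z) / C > 0" "cubic (q z) \<noteq> 0"
    using root[OF \<open>z \<in> I\<close>] \<open>C \<noteq> 0\<close> by auto
  then have nz': "q z \<noteq> 1" "q z + 2 \<noteq> 0" "q z + 1 \<noteq> 0" "q z - 1 \<noteq> 0"
    using assms by (auto simp: cubic_factor)
  have "(f has_real_derivative
      2 / 3 * (3 * ((q z)\<^sup>2 - 1) / C / (cubic (q z) / C))) (at (q z))"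
    unfolding f_def using nz \<open>C \<noteq> 0\<close>
    by (auto intro!: derivative_eq_intros DERIV_cubic simp: field_simps)
  moreover have "2 / 3 * (3 * ((q z)\<^sup>2 - 1) / C / (cubic (q z) / C)) = inverse (flow (q z))"
    using nz' \<open>C \<noteq> 0\<close> unfolding cubic_factor flow_def
    by (simp add: divide_simps power2_eq_square) algebra
  ultimately have D: "(f has_real_derivative inverse (flow (q z))) (at (q z))"
    by simp
  have "(q has_real_derivative inverse (inverse (flow (q z)))) (at z)"
  proof (rule DERIV_inverse_function[where f = f and g = q, OF D])
    show "inverse (flow (q z)) \<noteq> 0"
      using nz' by (simp add: flow_def)
    show "z - e < z" "z < z + e" using e by auto
    show "f (q w) = w" if "z - e < w" "w < z + e" for w
      using root[of w] e(2)[of w] that \<open>C \<noteq> 0\<close> by (auto simp: f_def)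
    show "isCont q z"
      using assms by (simp add: continuous_on_eq_continuous_at)
  qed
  then show ?thesis by simp
qed

text \<open>The second derivative of \<open>v\<close> is a rational function of \<open>q\<close>
  whose only pole is - 1, so a third derivative exists as soon as \<open>q\<close> is
  differentiable.\<close>

lemma flow_solves:
  assumes "b \<noteq> 0" "open I"
    and q: "\<And>z. z \<in> I \<Longrightarrow> (q has_real_derivative q' z) (at z)"
    and ne: "\<And>z. z \<in> I \<Longrightarrow> q z \<noteq> -1"
    and q': "\<And>z. z \<in> I \<Longrightarrow> q z * q' z = q z * flow (q z)"
    and v: "\<And>z. z \<in> I \<Longrightarrow> (v has_real_derivative (1 - (q z)\<^sup>2) / b) (at z)"
  shows "solves_ode2 b I v \<and> (\<forall>z\<in>I. deriv (deriv v) differentiable (at z))"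
proof -
  let ?P = "\<lambda>z. - 2 * (q z * flow (q z)) / b"
  have dv: "deriv v z = (1 - (q z)\<^sup>2) / b" if "z \<in> I" for z
    using v[OF that] by (rule DERIV_imp_deriv)
  have d2: "(deriv v has_real_derivative ?P z) (at z)" if "z \<in> I" for z
  proof -
    have "((\<lambda>z. (1 - (q z)\<^sup>2) / b) has_real_derivative - 2 * (q z * q' z) / b) (at z)"
      using q[OF that] \<open>b \<noteq> 0\<close> by (auto intro!: derivative_eq_intros)
    then have "((\<lambda>z. (1 - (q z)\<^sup>2) / b) has_real_derivative ?P z) (at z)"
      by (simp only: q'[OF that])
    then show ?thesis
      by (rule has_field_derivative_transform_within_open[OF _ \<open>open I\<close> that]) (simp add: dv)
  qed
  have dd: "deriv (deriv v) z = ?P z" if "z \<in> I" for z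
    using d2[OF that] by (rule DERIV_imp_deriv)
  have d3: "deriv (deriv v) differentiable (at z)" if "z \<in> I" for z
  proof -
    have "\<exists>D. ((\<lambda>z. flow (q z)) has_real_derivative D) (at z)"
      unfolding flow_def using q[OF that] ne[OF that]
      by (intro exI) (auto intro!: derivative_eq_intros)
    then obtain D where "((\<lambda>z. flow (q z)) has_real_derivative D) (at z)" ..
    then have "\<exists>D. (?P has_real_derivative D) (at z)"
      using q[OF that] by (intro exI) (auto intro!: derivative_eq_intros simp: \<open>b \<noteq> 0\<close>)
    then obtain D where "(?P has_real_derivative D) (at z)" ..
    then have "(deriv (deriv v) has_real_derivative D) (at z)"
      by (rule has_field_derivative_transform_within_open[OF _ \<open>open I\<close> that]) (simp add: dd)
    then show ?thesis using real_differentiable_def by blast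
  qed
  have "1 - b * (deriv (deriv v) z - deriv v z) \<noteq> 0 \<and>
      ode_lhs b (deriv v z) (deriv (deriv v) z) = 0" if "z \<in> I" for z
  proof -
    have n: "q z + 1 \<noteq> 0" using ne[OF that] by simp
    have s: "1 - b * (deriv (deriv v) z - deriv v z) = 2 / (q z + 1)"
      using \<open>b \<noteq> 0\<close> n unfolding dv[OF that] dd[OF that] flow_def
      by (simp add: divide_simps power2_eq_square) algebra
    have "b * (deriv (deriv v) z - deriv v z) = 1 - 2 / (q z + 1)"
      using s by linarith
    then have qd: "deriv (deriv v) z - deriv v z = (1 - 2 / (q z + 1)) / b"
      using \<open>b \<noteq> 0\<close> by (simp add: field_simps)
    have "ode_lhs b (deriv v z) (deriv (deriv v) z) = 0"
      unfolding ode_lhs_def s unfolding qd unfolding dv[OF that] using n \<open>b \<noteq> 0\<close>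
      by (simp add: divide_simps power2_eq_square) algebra
    with s n show ?thesis by simp
  qed
  then show ?thesis
    using d3 v d2 unfolding solves_ode2_def real_differentiable_def by blast
qed

section \<open>The critical point and the roots of the cubic in closed form\<close>

lemma exp_z_crit:
  assumes "c \<noteq> 0" shows "exp (3 * z_crit c / 2) = 4 / \<bar>c\<bar>"
proof -
  have "3 * z_crit c / 2 = ln ((2 / sqrt \<bar>c\<bar>)\<^sup>2)"
    using assms by (simp add: z_crit_def ln_realpow)
  also have "(2 / sqrt \<bar>c\<bar>)\<^sup>2 = 4 / \<bar>c\<bar>"
    by (simp add: power_divide)
  finally show ?thesis using assms by simp
qed

text \<open>The threshold 4 is \<open>cubic (- 1)\<close>, the local maximum of the cubic: for
  right-hand sides between 0 and 4 there are three real roots, beyond 4 only \<open>q_3\<close>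
  remains.\<close>

lemma le_z_crit_iff:
  assumes "c \<noteq> 0"
  shows "z \<le> z_crit c \<longleftrightarrow> \<bar>c\<bar> * exp (3 * z / 2) \<le> 4"
    and "z < z_crit c \<longleftrightarrow> \<bar>c\<bar> * exp (3 * z / 2) < 4"
proof -
  have "z \<le> z_crit c \<longleftrightarrow> exp (3 * z / 2) \<le> exp (3 * z_crit c / 2)"
    and "z < z_crit c \<longleftrightarrow> exp (3 * z / 2) < exp (3 * z_crit c / 2)" by simp_all
  moreover have "x \<le> 4 / \<bar>c\<bar> \<longleftrightarrow> \<bar>c\<bar> * x \<le> 4" "x < 4 / \<bar>c\<bar> \<longleftrightarrow> \<bar>c\<bar> * x < 4" for x
    using assms by (simp_all add: field_simps)
  ultimately show "z \<le> z_crit c \<longleftrightarrow> \<bar>c\<bar> * exp (3 * z / 2) \<le> 4"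
    and "z < z_crit c \<longleftrightarrow> \<bar>c\<bar> * exp (3 * z / 2) < 4"
    unfolding exp_z_crit[OF assms] by blast+
qed

text \<open>\<open>q_b\<close> is the only real root for a negative right-hand side. For a positive
  one, and before the critical point, \<open>q_1\<close>, \<open>q_2\<close>, \<open>q_3\<close> are
  the roots below - 1, between - 1 and 1, and above 1.\<close>

definition q_b :: "real \<Rightarrow> real \<Rightarrow> real" where
  "q_b c z = - (2 powr (1/3) / tau c z powr (1/3) + tau c z powr (1/3) / 2 powr (1/3))"

definition q_1 :: "real \<Rightarrow> real \<Rightarrow> real" where
  "q_1 c z = - 2 * cos (1/3 * alpha c z)"

definition q_2 :: "real \<Rightarrow> real \<Rightarrow> real" where
  "q_2 c z = - 2 * cos (1/3 * pi + 1/3 * beta c z)"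

definition q_3 :: "real \<Rightarrow> real \<Rightarrow> real" where
  "q_3 c z = (if z \<le> z_crit c then 2 * cos (1/3 * beta c z) else 2 * cosh (1/3 * gamma c z))"

text \<open>The substitution \<open>q = 2 cos t\<close> turns \<open>q^3 - 3 q\<close> into
  \<open>2 cos (3 t)\<close> by the triple-angle formula; \<open>2 cosh t\<close> does the same for
  values of at least 2.\<close>

lemma cubic_2cos: "cubic (2 * cos t) = 2 + 2 * cos (3 * t)"
  by (simp add: cubic_def cos_treble_cos power3_eq_cube)

lemma cubic_2cosh: "cubic (2 * cosh (t::real)) = 2 + 2 * cosh (3 * t)"
proof -
  have "cosh (3 * t) = 4 * cosh t ^ 3 - 3 * cosh t"
  proof -
    have "cosh (3 * t) = cosh (2 * t + t)" by simp
    also have "\<dots> = (2 * (cosh t)\<^sup>2 - 1) * cosh t + 2 * cosh t * (sinh t)\<^sup>2"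
      by (simp only: cosh_add cosh_double_cosh sinh_double power2_eq_square) simp
    also have "\<dots> = 4 * cosh t ^ 3 - 3 * cosh t"
      unfolding sinh_square_eq by (simp add: power2_eq_square power3_eq_cube algebra_simps)
    finally show ?thesis .
  qed
  then show ?thesis by (simp add: cubic_def power3_eq_cube)
qed

text \<open>The computation shared by \<open>v_1\<close>, \<open>v_2\<close> and both pieces of
  \<open>v_3\<close>. \<open>A\<close> is \<open>1 - q\<close> on the first two branches and
  \<open>q - 1\<close> on the third, so only its square is prescribed; \<open>4 B^2 = q + 2\<close>
  is a half-angle formula. The term \<open>z / b\<close> disappears because the logarithm of the
  cubic relation expresses \<open>z\<close> by \<open>ln A\<close> and
  \<open>ln (q + 2)\<close>.\<close>

lemma potential_parametric:
  assumes "K > 0" "b \<noteq> 0" and cub: "cubic q = K * exp (3 * z / 2)"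
    and A: "A\<^sup>2 = (q - 1)\<^sup>2" and B: "4 * B\<^sup>2 = q + 2" "B > 0"
    and t: "2 * t = q\<^sup>2 - 2"
  shows "z / b - 2 / b * t - 4 / (3 * b) * ln A - 16 / (3 * b) * ln B =
    potential q / b + (2 + 8 / 3 * ln 4 - 2 / 3 * ln K) / b"
proof -
  have q2: "q + 2 > 0" using B by (metis zero_less_power mult_pos_pos zero_less_numeral)
  have n1: "q \<noteq> 1" using assms by (auto simp: cubic_def)
  have lnA: "2 * ln A = ln ((q - 1)\<^sup>2)"
    using A by (metis ln_realpow of_nat_numeral)
  have lnB: "2 * ln B = ln (q + 2) - ln 4"
  proof -
    have "ln (4 * B\<^sup>2) = ln 4 + 2 * ln B" using B(2) by (simp add: ln_mult ln_realpow)
    then show ?thesis using B by simp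
  qed
  have "ln (cubic q) = ln K + 3 * z / 2"
    using \<open>K > 0\<close> unfolding cub by (simp add: ln_mult)
  moreover have "ln (cubic q) = 2 * ln A + ln (q + 2)"
    unfolding cubic_factor lnA using n1 q2 by (intro ln_mult_pos) auto
  ultimately have z: "z = 2 / 3 * (2 * ln A + ln (q + 2) - ln K)"
    by (simp add: field_simps)
  have p: "potential q = - 2 * t - 2 - 2 * ln (q + 2)"
    using q2 t by (simp add: potential_def ln_realpow)
  have "z - 2 * t - 4 / 3 * ln A - 16 / 3 * ln B =
      potential q + (2 + 8 / 3 * ln 4 - 2 / 3 * ln K)"
    unfolding p using z lnB by (simp add: field_simps)
  moreover have "z / b - 2 / b * t - 4 / (3 * b) * ln A - 16 / (3 * b) * ln B =
      (z - 2 * t - 4 / 3 * ln A - 16 / 3 * ln B) / b"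
    by (simp add: diff_divide_distrib)
  ultimately show ?thesis by (simp add: add_divide_distrib)
qed

section \<open>Roots of the cubic and the listed formulas\<close>

lemma tau_root:
  assumes "c > 0"
  defines "x \<equiv> \<lambda>z. tau c z powr (1/3) / 2 powr (1/3)"
  shows "tau c z > 2" "x z > 1" "x z ^ 3 = tau c z / 2" "q_b c z = - (x z + 1 / x z)"
    "(x z)\<^sup>2 = tau c z powr (2/3) / 2 powr (2/3)"
proof -
  have "c * exp (3 * z / 2) > 0" using assms by simp
  moreover have "sqrt (4 * c * exp (3 * z / 2) + c\<^sup>2 * exp (3 * z)) \<ge> 0"
    using assms by simp
  ultimately show t: "tau c z > 2" unfolding tau_def by linarith
  have x: "x z = (tau c z / 2) powr (1/3)" using t by (simp add: x_def powr_divide)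
  show "x z > 1" unfolding x using t by simp
  show "x z ^ 3 = tau c z / 2"
    unfolding x using t by (simp add: powr_power)
  show "q_b c z = - (x z + 1 / x z)" by (simp add: q_b_def x_def)
  have "(x z)\<^sup>2 = (tau c z / 2) powr (2/3)"
    unfolding x using t by (simp add: powr_power)
  then show "(x z)\<^sup>2 = tau c z powr (2/3) / 2 powr (2/3)"
    using t by (simp add: powr_divide)
qed

lemma cubic_q_b:
  assumes "c > 0" shows "cubic (q_b c z) = - c * exp (3 * z / 2)" "q_b c z < - 2"
proof -
  define x where "x = tau c z powr (1/3) / 2 powr (1/3)"
  note t = tau_root[OF assms, of z, folded x_def]
  define e where "e = c * exp (3 * z / 2)"
  define w where "w = sqrt (4 * e + e\<^sup>2)"
  have e: "e > 0" using assms by (simp add: e_def)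
  have tau: "tau c z = 2 + e + w"
    unfolding tau_def w_def e_def
    by (simp add: power_mult_distrib algebra_simps flip: exp_double)
  have w: "w\<^sup>2 = 4 * e + e\<^sup>2" using e by (simp add: w_def)
  \<comment> \<open>Cardano's resolvent: \<open>(2 + e)^2 - w^2 = 4\<close>, so half of
    \<open>tau c z\<close> and half of its conjugate are reciprocal, and they sum to
    \<open>2 + e\<close>.\<close>
  have prod: "(tau c z / 2) * (2 + e - w) = 2"
    unfolding tau using w by (simp add: power2_eq_square algebra_simps)
  then have "1 / x ^ 3 = (2 + e - w) / 2"
    unfolding t(3) using t(1) by (simp add: field_simps)
  then have "x ^ 3 + 1 / x ^ 3 = 2 + e" unfolding t(3) tau by (simp add: field_simps)
  moreover have "cubic (- (x + 1 / x)) = 2 - (x ^ 3 + 1 / x ^ 3)"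
  proof -
    define y where "y = 1 / x"
    have "x * y = 1" using t(2) by (simp add: y_def)
    then have "cubic (- (x + y)) = 2 - (x ^ 3 + y ^ 3)"
      unfolding cubic_def by algebra
    then show ?thesis by (simp add: y_def power_one_over)
  qed
  ultimately show "cubic (q_b c z) = - c * exp (3 * z / 2)"
    unfolding t(4) by (simp add: e_def)
  \<comment> \<open>The arithmetic-geometric mean inequality, strict because
    \<open>x > 1\<close>.\<close>
  have "0 < (x - 1)\<^sup>2 / x" using t(2) by simp
  also have "(x - 1)\<^sup>2 / x = x + 1 / x - 2"
    using t(2) by (simp add: power2_eq_square field_simps)
  finally show "q_b c z < - 2" unfolding t(4) by simp
qed

text \<open>The logarithm in \<open>v_b\<close> has the argument \<open>- (q_b c z + 2)\<close>,
  positive because \<open>q_b c z < - 2\<close>; the constant \<open>2 / b\<close> is the cross term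
  of \<open>(x + 1 / x)^2\<close>.\<close>

lemma v_b_eq:
  assumes "c > 0" "b \<noteq> 0"
  shows "v_b b c d z = potential (q_b c z) / b + (2 / b + d)"
proof -
  define x where "x = tau c z powr (1/3) / 2 powr (1/3)"
  note t = tau_root[OF assms(1), of z, folded x_def]
  have s: "2 powr (2/3) / (b * tau c z powr (2/3)) = 1 / (b * x\<^sup>2)"
    "tau c z powr (2/3) / (b * 2 powr (2/3)) = x\<^sup>2 / b"
    "2 powr (1/3) / tau c z powr (1/3) + tau c z powr (1/3) / 2 powr (1/3) - 2 = - (q_b c z + 2)"
    unfolding t(5) by (simp_all add: q_b_def field_simps)
  have "potential (q_b c z) = - (x + 1 / x)\<^sup>2 - 2 * ln (- (q_b c z + 2))"
  proof -
    have "ln ((- (q_b c z + 2))\<^sup>2) = 2 * ln (- (q_b c z + 2))"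
      by (simp only: ln_realpow of_nat_numeral)
    then have "ln ((q_b c z + 2)\<^sup>2) = 2 * ln (- (q_b c z + 2))"
      by (simp only: power2_minus)
    moreover have "(q_b c z)\<^sup>2 = (x + 1 / x)\<^sup>2" unfolding t(4) by (simp only: power2_minus)
    ultimately show ?thesis by (simp only: potential_def)
  qed
  moreover have "(x + 1 / x)\<^sup>2 = 2 + 1 / x\<^sup>2 + x\<^sup>2"
    using t(2) by (simp add: power2_eq_square field_simps)
  ultimately have "potential (q_b c z) = - 2 - 1 / x\<^sup>2 - x\<^sup>2 - 2 * ln (- (q_b c z + 2))"
    by simp
  then show ?thesis
    unfolding v_b_def s by (simp add: diff_divide_distrib mult.commute)
qed

lemma alpha_props:
  assumes "c \<noteq> 0" "z \<le> z_crit c"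
  shows "0 < alpha c z" "alpha c z \<le> pi" "cos (alpha c z) = 1 - \<bar>c\<bar> / 2 * exp (3 * z / 2)"
proof -
  have e: "0 < \<bar>c\<bar> * exp (3 * z / 2)" "\<bar>c\<bar> * exp (3 * z / 2) \<le> 4"
    using assms le_z_crit_iff by auto
  then show c: "cos (alpha c z) = 1 - \<bar>c\<bar> / 2 * exp (3 * z / 2)"
    by (simp add: alpha_def)
  show "alpha c z \<le> pi" using e by (simp add: alpha_def arccos_ubound)
  have "0 \<le> alpha c z" using e by (simp add: alpha_def arccos_lbound)
  moreover have "alpha c z \<noteq> 0" using c e by auto
  ultimately show "0 < alpha c z" by simp
qed

lemma beta_props:
  assumes "c \<noteq> 0" "z \<le> z_crit c"
  shows "0 \<le> beta c z" "beta c z < pi" "cos (beta c z) = - 1 + \<bar>c\<bar> / 2 * exp (3 * z / 2)"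
proof -
  have e: "0 < \<bar>c\<bar> * exp (3 * z / 2)" "\<bar>c\<bar> * exp (3 * z / 2) \<le> 4"
    using assms le_z_crit_iff by auto
  then show c: "cos (beta c z) = - 1 + \<bar>c\<bar> / 2 * exp (3 * z / 2)"
    by (simp add: beta_def)
  show "0 \<le> beta c z" using e by (simp add: beta_def arccos_lbound)
  have "beta c z \<le> pi" using e by (simp add: beta_def arccos_ubound)
  moreover have "beta c z \<noteq> pi" using c e by auto
  ultimately show "beta c z < pi" by simp
qed

lemma gamma_props:
  assumes "c \<noteq> 0" "z_crit c \<le> z"
  shows "0 \<le> gamma c z" "cosh (gamma c z) = - 1 + \<bar>c\<bar> / 2 * exp (3 * z / 2)"
proof -
  have "4 \<le> \<bar>c\<bar> * exp (3 * z / 2)"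
    using assms le_z_crit_iff(2)[OF assms(1), of z] by linarith
  then show "0 \<le> gamma c z" "cosh (gamma c z) = - 1 + \<bar>c\<bar> / 2 * exp (3 * z / 2)"
    by (simp_all add: gamma_def)
qed

lemma two_cos_range:
  assumes "0 \<le> t" "t \<le> pi / 3" shows "1 \<le> 2 * cos t"
    "t < pi / 3 \<Longrightarrow> 1 < 2 * cos t" "0 < t \<Longrightarrow> 2 * cos t < 2"
proof -
  show "1 \<le> 2 * cos t" using cos_monotone_0_pi_le[of t "pi / 3"] assms by (simp add: cos_60)
  show "1 < 2 * cos t" if "t < pi / 3" using cos_monotone_0_pi[of t "pi / 3"] that assms by (simp add: cos_60)
  show "2 * cos t < 2" if "0 < t" using cos_monotone_0_pi[of 0 t] that assms pi_gt_zero by simp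
qed

lemma cubic_q_1:
  assumes "c \<noteq> 0" "z \<le> z_crit c"
  shows "cubic (q_1 c z) = \<bar>c\<bar> * exp (3 * z / 2)" "-2 < q_1 c z" "q_1 c z \<le> - 1"
    "z < z_crit c \<Longrightarrow> q_1 c z < - 1"
proof -
  note a = alpha_props[OF assms]
  show "-2 < q_1 c z" "q_1 c z \<le> - 1"
    using two_cos_range[of "1/3 * alpha c z"] a by (simp_all add: q_1_def)
  have "cubic (- (2 * cos t)) = 2 - 2 * cos (3 * t)" for t
    by (simp add: cubic_def cos_treble_cos power3_eq_cube)
  from this[of "1/3 * alpha c z"] show cub: "cubic (q_1 c z) = \<bar>c\<bar> * exp (3 * z / 2)"
    by (simp add: q_1_def a(3))
  show "q_1 c z < - 1" if "z < z_crit c"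
  proof -
    \<comment> \<open>The value - 1 would make the right-hand side 4, which is reached only at
      \<open>z_crit c\<close>.\<close>
    have "q_1 c z \<noteq> -1"
      using cub that le_z_crit_iff(2)[OF assms(1), of z] by (auto simp: cubic_def)
    then show ?thesis using \<open>q_1 c z \<le> -1\<close> by simp
  qed
qed

text \<open>The shift by \<open>pi / 3\<close> selects the middle root: the angle stays in
  \<open>[pi / 3, 2 pi / 3)\<close>, where \<open>- 2 cos\<close> increases from - 1 towards 1, and
  tripling the angle turns the shift into a change of sign.\<close>

lemma cubic_q_2:
  assumes "c \<noteq> 0" "z \<le> z_crit c"
  shows "cubic (q_2 c z) = \<bar>c\<bar> * exp (3 * z / 2)" "- 1 \<le> q_2 c z" "q_2 c z < 1"
    "z < z_crit c \<Longrightarrow> - 1 < q_2 c z"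
proof -
  note a = beta_props[OF assms]
  define t where "t = 1/3 * pi + 1/3 * beta c z"
  have t: "pi / 3 \<le> t" "t < 2 * pi / 3" using a by (auto simp: t_def)
  have q: "q_2 c z = - 2 * cos t" by (simp only: q_2_def t_def)
  have "cos t \<le> 1 / 2"
    using cos_monotone_0_pi_le[of "pi / 3" t] t pi_gt_zero by (simp add: cos_60)
  then show q1: "- 1 \<le> q_2 c z" by (simp add: q)
  have "- (1 / 2) < cos t"
    using cos_monotone_0_pi[of t "2 * pi / 3"] t pi_gt_zero cos_120 by simp
  then show "q_2 c z < 1" by (simp add: q)
  have "cubic (- (2 * cos t)) = 2 - 2 * cos (3 * t)"
    by (simp add: cubic_def cos_treble_cos power3_eq_cube)
  moreover have "cos (3 * t) = - cos (beta c z)"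
    by (simp add: t_def distrib_left cos_add)
  ultimately show cub: "cubic (q_2 c z) = \<bar>c\<bar> * exp (3 * z / 2)"
    by (simp add: q a(3))
  show "- 1 < q_2 c z" if "z < z_crit c"
  proof -
    have "q_2 c z \<noteq> -1"
      using cub that le_z_crit_iff(2)[OF assms(1), of z] by (auto simp: cubic_def)
    then show ?thesis using q1 by simp
  qed
qed

lemma cubic_q_3:
  assumes "c \<noteq> 0"
  shows "cubic (q_3 c z) = \<bar>c\<bar> * exp (3 * z / 2)" "1 < q_3 c z"
proof -
  have "cubic (q_3 c z) = \<bar>c\<bar> * exp (3 * z / 2) \<and> 1 < q_3 c z"
  proof (cases "z \<le> z_crit c")
    case True
    note a = beta_props[OF assms True]
    show ?thesis
      using True cubic_2cos[of "1/3 * beta c z"] two_cos_range(2)[of "1/3 * beta c z"] a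
      by (simp add: q_3_def)
  next
    case False
    then have a: "0 \<le> gamma c z" "cosh (gamma c z) = - 1 + \<bar>c\<bar> / 2 * exp (3 * z / 2)"
      using gamma_props[OF assms] by auto
    have "1 \<le> cosh (1/3 * gamma c z)" by (rule cosh_real_ge_1)
    then show ?thesis
      using False cubic_2cosh[of "1/3 * gamma c z"] a by (simp add: q_3_def)
  qed
  then show "cubic (q_3 c z) = \<bar>c\<bar> * exp (3 * z / 2)" "1 < q_3 c z" by auto
qed

lemma cos_sixth: "cos (1/3 * t) = 1 - 2 * (sin (1/6 * t))\<^sup>2" "cos (1/3 * t) = 2 * (cos (1/6 * t))\<^sup>2 - 1"
  for t :: real
  using cos_double_sin[of "1/6 * t"] cos_double_cos[of "1/6 * t"] by simp_all

lemma v_1_eq: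
  assumes "c \<noteq> 0" "b \<noteq> 0" "z \<le> z_crit c"
  shows "v_1 b c d z = potential (q_1 c z) / b + ((2 + 8 / 3 * ln 4 - 2 / 3 * ln \<bar>c\<bar>) / b + d)"
proof -
  note a = alpha_props[OF assms(1,3)]
  have "z / b - 2 / b * cos (2/3 * alpha c z)
     - 4 / (3 * b) * ln (1 + 2 * cos (1/3 * alpha c z))
     - 16 / (3 * b) * ln (sin (1/6 * alpha c z)) =
     potential (q_1 c z) / b + (2 + 8 / 3 * ln 4 - 2 / 3 * ln \<bar>c\<bar>) / b"
  proof (rule potential_parametric)
    show "(1 + 2 * cos (1/3 * alpha c z))\<^sup>2 = (q_1 c z - 1)\<^sup>2"
      by (simp add: q_1_def power2_eq_square algebra_simps)
    show "4 * (sin (1/6 * alpha c z))\<^sup>2 = q_1 c z + 2"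
      by (simp only: q_1_def cos_sixth(1)) simp
    show "sin (1/6 * alpha c z) > 0" using a by (intro sin_gt_zero) auto
    show "2 * cos (2/3 * alpha c z) = (q_1 c z)\<^sup>2 - 2"
      using cos_double_cos[of "1/3 * alpha c z"] by (simp add: q_1_def power_mult_distrib)
  qed (use assms cubic_q_1 in auto)
  then show ?thesis unfolding v_1_def by simp
qed

lemma v_2_eq:
  assumes "c \<noteq> 0" "b \<noteq> 0" "z \<le> z_crit c"
  shows "v_2 b c d z = potential (q_2 c z) / b + ((2 + 8 / 3 * ln 4 - 2 / 3 * ln \<bar>c\<bar>) / b + d)"
proof -
  note a = beta_props[OF assms(1,3)]
  have "z / b - 2 / b * cos (2/3 * pi + 2/3 * beta c z)
     - 4 / (3 * b) * ln (1 + 2 * cos (1/3 * pi + 1/3 * beta c z))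
     - 16 / (3 * b) * ln (sin (1/6 * pi + 1/6 * beta c z)) =
     potential (q_2 c z) / b + (2 + 8 / 3 * ln 4 - 2 / 3 * ln \<bar>c\<bar>) / b"
  proof (rule potential_parametric)
    show "(1 + 2 * cos (1/3 * pi + 1/3 * beta c z))\<^sup>2 = (q_2 c z - 1)\<^sup>2"
      by (simp add: q_2_def power2_eq_square algebra_simps)
    show "4 * (sin (1/6 * pi + 1/6 * beta c z))\<^sup>2 = q_2 c z + 2"
      using cos_sixth(1)[of "pi + beta c z"] by (simp add: q_2_def distrib_left)
    show "sin (1/6 * pi + 1/6 * beta c z) > 0" using a by (intro sin_gt_zero) auto
    show "2 * cos (2/3 * pi + 2/3 * beta c z) = (q_2 c z)\<^sup>2 - 2"
      using cos_double_cos[of "1/3 * pi + 1/3 * beta c z"]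
      by (simp add: q_2_def power_mult_distrib distrib_left)
  qed (use assms cubic_q_2 in auto)
  then show ?thesis unfolding v_2_def by simp
qed

lemma v_3_eq:
  assumes "c \<noteq> 0" "b \<noteq> 0"
  shows "v_3 b c d z = potential (q_3 c z) / b + ((2 + 8 / 3 * ln 4 - 2 / 3 * ln \<bar>c\<bar>) / b + d)"
proof (cases "z \<le> z_crit c")
  case True
  note a = beta_props[OF assms(1) True]
  have q: "q_3 c z = 2 * cos (1/3 * beta c z)" using True by (simp add: q_3_def)
  have "z / b - 2 / b * cos (2/3 * beta c z)
     - 4 / (3 * b) * ln (- 1 + 2 * cos (1/3 * beta c z))
     - 16 / (3 * b) * ln (cos (1/6 * beta c z)) =
     potential (q_3 c z) / b + (2 + 8 / 3 * ln 4 - 2 / 3 * ln \<bar>c\<bar>) / b"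
  proof (rule potential_parametric)
    show "(- 1 + 2 * cos (1/3 * beta c z))\<^sup>2 = (q_3 c z - 1)\<^sup>2" by (simp add: q)
    show "4 * (cos (1/6 * beta c z))\<^sup>2 = q_3 c z + 2"
      by (simp only: q cos_sixth(2)) simp
    show "cos (1/6 * beta c z) > 0" using a by (intro cos_gt_zero_pi) auto
    show "2 * cos (2/3 * beta c z) = (q_3 c z)\<^sup>2 - 2"
      using cos_double_cos[of "1/3 * beta c z"] by (simp add: q power_mult_distrib)
  qed (use assms cubic_q_3 in auto)
  then show ?thesis unfolding v_3_def v_31_def using True by simp
next
  case False
  have q: "q_3 c z = 2 * cosh (1/3 * gamma c z)" using False by (simp add: q_3_def)
  have "z / b - 2 / b * cosh (2/3 * gamma c z)
     - 4 / (3 * b) * ln (- 1 + 2 * cosh (1/3 * gamma c z))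
     - 16 / (3 * b) * ln (cosh (1/6 * gamma c z)) =
     potential (q_3 c z) / b + (2 + 8 / 3 * ln 4 - 2 / 3 * ln \<bar>c\<bar>) / b"
  proof (rule potential_parametric)
    show "(- 1 + 2 * cosh (1/3 * gamma c z))\<^sup>2 = (q_3 c z - 1)\<^sup>2" by (simp add: q)
    show "4 * (cosh (1/6 * gamma c z))\<^sup>2 = q_3 c z + 2"
      using cosh_double_cosh[of "1/6 * gamma c z"] by (simp add: q)
    show "cosh (1/6 * gamma c z) > 0" by simp
    show "2 * cosh (2/3 * gamma c z) = (q_3 c z)\<^sup>2 - 2"
      using cosh_double_cosh[of "1/3 * gamma c z"] by (simp add: q power_mult_distrib)
  qed (use assms cubic_q_3 in auto)
  then show ?thesis unfolding v_3_def v_32_def using False by simp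
qed

section \<open>Continuity of the explicit roots\<close>

lemma continuous_q_b: "c > 0 \<Longrightarrow> continuous_on UNIV (q_b c)"
proof -
  assume "c > 0"
  then have "tau c z \<noteq> 0" for z using tau_root(1)[of c z] by simp
  moreover have "continuous_on UNIV (tau c)"
    unfolding tau_def [abs_def] by (intro continuous_intros) auto
  ultimately show "continuous_on UNIV (q_b c)"
    unfolding q_b_def [abs_def] by (auto intro!: continuous_intros)
qed

lemma continuous_q_1: "c \<noteq> 0 \<Longrightarrow> continuous_on {..z_crit c} (q_1 c)"
  unfolding q_1_def [abs_def] alpha_def [abs_def]
  using le_z_crit_iff(1)[of c] by (auto intro!: continuous_intros)

lemma continuous_beta: "c \<noteq> 0 \<Longrightarrow> continuous_on {..z_crit c} (beta c)"
  unfolding beta_def [abs_def]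
  using le_z_crit_iff(1)[of c] by (auto intro!: continuous_intros)

lemma continuous_q_2: "c \<noteq> 0 \<Longrightarrow> continuous_on {..z_crit c} (q_2 c)"
  unfolding q_2_def [abs_def] by (auto intro!: continuous_intros continuous_beta)

lemma continuous_q_3:
  assumes "c \<noteq> 0" shows "continuous_on UNIV (q_3 c)"
proof -
  have g: "continuous_on {z_crit c..} (gamma c)"
    unfolding gamma_def [abs_def]
  proof (intro continuous_intros)
    fix z assume "z \<in> {z_crit c..}"
    then show "1 \<le> - 1 + \<bar>c\<bar> / 2 * exp (3 * z / 2)"
      using le_z_crit_iff(2)[OF assms, of z] by auto
  qed simp
  \<comment> \<open>At the junction both angles vanish, so the two expressions share the value 2.
    Nothing else has to be matched there: the derivative comes from the cubic relation.\<close>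
  have "beta c (z_crit c) = 0" "gamma c (z_crit c) = 0"
    using exp_z_crit[OF assms] assms by (simp_all add: beta_def gamma_def)
  then have "continuous_on ({..z_crit c} \<union> {z_crit c..}) (q_3 c)"
    unfolding q_3_def [abs_def]
    by (intro continuous_on_cases continuous_intros continuous_beta assms g) auto
  moreover have "{..z_crit c} \<union> {z_crit c..} = UNIV" by auto
  ultimately show ?thesis by simp
qed

text \<open>Dividing \<open>cubic q - cubic r\<close> by \<open>q - r\<close> leaves
  \<open>q^2 + q r + r^2 - 3\<close>. If both numbers lie beyond the same critical point, all three
  products exceed 1; between the critical points all are below 1 in absolute value.\<close>

lemma cubic_inj_on_branches:
  assumes "cubic q = cubic r"
    and "1 < q \<and> 1 < r \<or> q < - 1 \<and> r < - 1 \<or> \<bar>q\<bar> < 1 \<and> \<bar>r\<bar> < 1"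
  shows "q = r"
proof -
  have "(q - r) * (q * q + q * r + r * r - 3) = 0"
    using assms(1) unfolding cubic_def by algebra
  moreover have "q * q + q * r + r * r \<noteq> 3"
    using assms(2)
  proof (elim disjE conjE)
    assume "1 < q" "1 < r"
    then have "1 < q * q" "1 < q * r" "1 < r * r" by (simp_all add: less_1_mult)
    then show ?thesis by simp
  next
    assume "q < - 1" "r < - 1"
    then have "1 < (- q) * (- q)" "1 < (- q) * (- r)" "1 < (- r) * (- r)"
      using less_1_mult[of "- q" "- q"] less_1_mult[of "- q" "- r"] less_1_mult[of "- r" "- r"]
      by simp_all
    then show ?thesis by simp
  next
    assume "\<bar>q\<bar> < 1" "\<bar>r\<bar> < 1"
    then have "\<bar>q * q\<bar> < 1" "\<bar>q * r\<bar> < 1" "\<bar>r * r\<bar> < 1"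
      using abs_mult_less[of q 1 q 1] abs_mult_less[of q 1 r 1] abs_mult_less[of r 1 r 1]
      by (simp_all add: abs_mult)
    then show ?thesis by simp
  qed
  ultimately show ?thesis by simp
qed

lemma potential_flow:
  assumes "(q has_real_derivative flow (q z)) (at z)" "q z \<noteq> - 1" "q z \<noteq> - 2"
  shows "((\<lambda>z. potential (q z) / b + d) has_real_derivative (1 - (q z)\<^sup>2) / b) (at z)"
proof -
  have n: "q z + 2 \<noteq> 0" "q z + 1 \<noteq> 0" using assms by auto
  have "- 2 * (q z + 1)\<^sup>2 / (q z + 2) * flow (q z) = 1 - (q z)\<^sup>2"
    using n unfolding flow_def by (simp add: divide_simps power2_eq_square) algebra
  then show ?thesis
    using DERIV_potential[OF assms(1,3)]
    by (cases "b = 0") (auto intro!: derivative_eq_intros)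
qed

text \<open>The factor \<open>q z\<close> in \<open>q z * q' z = q z * flow (q z)\<close> admits the exceptional solution \<open>q = 0\<close>.\<close>

definition flow_pair :: "real \<Rightarrow> real set \<Rightarrow> (real \<Rightarrow> real) \<Rightarrow> bool" where
  "flow_pair b J f \<longleftrightarrow> open J \<and> (\<exists>q q'. \<forall>z\<in>J. (q has_real_derivative q' z) (at z) \<and> q z \<noteq> - 1 \<and>
     q z * q' z = q z * flow (q z) \<and> (f has_real_derivative (1 - (q z)\<^sup>2) / b) (at z))"

text \<open>Reduces each explicit formula to three checks: continuity of its root, the cubic
  relation, and agreement with the primitive up to a constant.\<close>

lemma flow_pair_cubic:
  assumes "open J" "continuous_on J q" "C \<noteq> 0"
    and root: "\<And>z. z \<in> J \<Longrightarrow> cubic (q z) = C * exp (3 * z / 2)"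
    and ne: "\<And>z. z \<in> J \<Longrightarrow> q z \<noteq> - 1"
    and f: "\<And>z. z \<in> J \<Longrightarrow> f z = potential (q z) / b + d"
  shows "flow_pair b J f"
  unfolding flow_pair_def
proof (intro conjI exI ballI)
  fix z assume z: "z \<in> J"
  show q: "(q has_real_derivative flow (q z)) (at z)"
    by (rule cubic_root_DERIV[OF assms(1-3) z root ne[OF z]])
  have "q z \<noteq> - 2" using root[OF z] \<open>C \<noteq> 0\<close> by (auto simp: cubic_factor)
  from potential_flow[OF q ne[OF z] this, of b d]
  show "(f has_real_derivative (1 - (q z)\<^sup>2) / b) (at z)"
    by (rule has_field_derivative_transform_within_open[OF _ \<open>open J\<close> z]) (simp add: f)
qed (use assms in auto)

lemma solution_family_flow:
  assumes "b \<noteq> 0" "(J, f) \<in> solution_family b"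
  shows "flow_pair b J f"
proof -
  \<comment> \<open>Constant lifts: 1 and - 2 are the zeros of \<open>flow\<close>, and 0 is the
    exceptional value. The slopes \<open>(1 - q^2) / b\<close> are those of the three listed
    lines.\<close>
  have line: "flow_pair b UNIV (\<lambda>z. (1 - q\<^sup>2) / b * z + d)"
    if "q \<noteq> - 1" "q * flow q = 0" for q d
    unfolding flow_pair_def using that assms(1)
    by (intro conjI open_UNIV exI[of _ "\<lambda>z. q"] exI[of _ "\<lambda>z. 0"] ballI)
      (auto intro!: derivative_eq_intros)
  show ?thesis
    using assms(2) unfolding solution_family_def
  proof (elim UnE CollectE exE conjE Pair_inject)
    fix d assume "J = UNIV" "f = (\<lambda>z. d)"
    then show ?thesis using line[of 1 d] by (simp add: flow_def)
  next
    fix d assume "J = UNIV" "f = (\<lambda>z. - (3 / b) * z + d)"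
    then show ?thesis using line[of "- 2" d] by (simp add: flow_def)
  next
    fix d assume "J = UNIV" "f = (\<lambda>z. 1 / b * z + d)"
    then show ?thesis using line[of 0 d] by simp
  next
    fix c d :: real assume fam: "J = UNIV" "f = v_b b c d" and c: "c > 0"
    show ?thesis unfolding fam
    proof (rule flow_pair_cubic)
      show "cubic (q_b c z) = - c * exp (3 * z / 2)" for z by (rule cubic_q_b(1)[OF c])
      show "q_b c z \<noteq> - 1" for z using cubic_q_b(2)[OF c, of z] by simp
    qed (use c continuous_q_b v_b_eq assms(1) in auto)
  next
    fix c d :: real assume fam: "J = {..< z_crit c}" "f = v_1 b c d" and c: "c < 0"
    then have "c \<noteq> 0" by simp
    show ?thesis unfolding fam
    proof (rule flow_pair_cubic)
      show "continuous_on {..<z_crit c} (q_1 c)"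
        by (rule continuous_on_subset[OF continuous_q_1[OF \<open>c \<noteq> 0\<close>]]) auto
      show "cubic (q_1 c z) = \<bar>c\<bar> * exp (3 * z / 2)" if "z \<in> {..<z_crit c}" for z
        using cubic_q_1(1)[OF \<open>c \<noteq> 0\<close>] that by simp
      show "q_1 c z \<noteq> - 1" if "z \<in> {..<z_crit c}" for z
        using cubic_q_1(4)[OF \<open>c \<noteq> 0\<close>, of z] that by simp
      show "v_1 b c d z = potential (q_1 c z) / b + ((2 + 8 / 3 * ln 4 - 2 / 3 * ln \<bar>c\<bar>) / b + d)"
        if "z \<in> {..<z_crit c}" for z
        using v_1_eq[OF \<open>c \<noteq> 0\<close> assms(1)] that by simp
    qed (use \<open>c \<noteq> 0\<close> in auto)
  next
    fix c d :: real assume fam: "J = {..< z_crit c}" "f = v_2 b c d" and c: "c < 0"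
    then have "c \<noteq> 0" by simp
    show ?thesis unfolding fam
    proof (rule flow_pair_cubic)
      show "continuous_on {..<z_crit c} (q_2 c)"
        by (rule continuous_on_subset[OF continuous_q_2[OF \<open>c \<noteq> 0\<close>]]) auto
      show "cubic (q_2 c z) = \<bar>c\<bar> * exp (3 * z / 2)" if "z \<in> {..<z_crit c}" for z
        using cubic_q_2(1)[OF \<open>c \<noteq> 0\<close>] that by simp
      show "q_2 c z \<noteq> - 1" if "z \<in> {..<z_crit c}" for z
        using cubic_q_2(4)[OF \<open>c \<noteq> 0\<close>, of z] that by simp
      show "v_2 b c d z = potential (q_2 c z) / b + ((2 + 8 / 3 * ln 4 - 2 / 3 * ln \<bar>c\<bar>) / b + d)"
        if "z \<in> {..<z_crit c}" for z
        using v_2_eq[OF \<open>c \<noteq> 0\<close> assms(1)] that by simp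
    qed (use \<open>c \<noteq> 0\<close> in auto)
  next
    fix c d :: real assume fam: "J = UNIV" "f = v_3 b c d" and c: "c < 0"
    then have "c \<noteq> 0" by simp
    show ?thesis unfolding fam
    proof (rule flow_pair_cubic)
      show "cubic (q_3 c z) = \<bar>c\<bar> * exp (3 * z / 2)" for z
        using cubic_q_3(1)[OF \<open>c \<noteq> 0\<close>] .
      show "q_3 c z \<noteq> - 1" for z
        using cubic_q_3(2)[OF \<open>c \<noteq> 0\<close>, of z] by simp
      show "v_3 b c d z = potential (q_3 c z) / b + ((2 + 8 / 3 * ln 4 - 2 / 3 * ln \<bar>c\<bar>) / b + d)" for z
        by (rule v_3_eq[OF \<open>c \<noteq> 0\<close> assms(1)])
    qed (use \<open>c \<noteq> 0\<close> continuous_q_3 in auto)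
  qed
qed

lemma flow_pair_solves:
  assumes "b \<noteq> 0" "flow_pair b J f" "open I" "I \<subseteq> J" "\<And>z. z \<in> I \<Longrightarrow> v z = f z"
  shows "solves_ode2 b I v \<and> (\<forall>z\<in>I. deriv (deriv v) differentiable (at z))"
proof -
  from assms(2) obtain q q' where q: "\<forall>z\<in>J. (q has_real_derivative q' z) (at z) \<and> q z \<noteq> - 1 \<and>
     q z * q' z = q z * flow (q z) \<and> (f has_real_derivative (1 - (q z)\<^sup>2) / b) (at z)"
    unfolding flow_pair_def by blast
  have "(v has_real_derivative (1 - (q z)\<^sup>2) / b) (at z)" if "z \<in> I" for z
  proof -
    have "(f has_real_derivative (1 - (q z)\<^sup>2) / b) (at z)" using q that assms(4) by blast
    then show ?thesis
      by (rule has_field_derivative_transform_within_open[OF _ \<open>open I\<close> that]) (simp add: assms(5))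
  qed
  then show ?thesis
    using q assms(4) by (intro flow_solves[OF assms(1,3), of q q']) auto
qed

lemma listed_on_solves:
  assumes "b \<noteq> 0" "open I" "listed_on b I v"
  shows "solves_ode2 b I v \<and> (\<forall>z\<in>I. deriv (deriv v) differentiable (at z))"
  using assms(3) flow_pair_solves[OF assms(1) solution_family_flow[OF assms(1)] assms(2)]
  unfolding listed_on_def by blast

section \<open>Domains of the explicit formulas\<close>

lemma dom_b_eq: "c > 0 \<Longrightarrow> dom_b c = UNIV"
proof -
  assume c: "c > 0"
  have "2 powr (1/3) / tau c z powr (1/3) + tau c z powr (1/3) / 2 powr (1/3) - 2 > 0" for z
    using cubic_q_b(2)[OF c, of z] by (simp add: q_b_def)
  moreover have "tau c z > 0" for z using tau_root(1)[OF c, of z] by simp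
  ultimately show ?thesis using c unfolding dom_b_def by auto
qed

text \<open>The arguments of the logarithms are positive wherever the \<open>arccos\<close> is
  meaningful: one is \<open>1 - q_1 c z\<close>, the other the sine of an angle in
  \<open>(0, pi / 6]\<close>.\<close>

lemma dom_1_eq: assumes "c \<noteq> 0" shows "dom_1 c = {..z_crit c}"
proof -
  have r: "1 - \<bar>c\<bar> / 2 * exp (3 * z / 2) \<in> {-1..1} \<longleftrightarrow> z \<le> z_crit c" for z
    using le_z_crit_iff(1)[OF assms, of z] by auto
  have "0 < 1 + 2 * cos (1/3 * alpha c z)" "0 < sin (1/6 * alpha c z)" if "z \<le> z_crit c" for z
    using cubic_q_1(3)[OF assms that] alpha_props[OF assms that] by (simp_all add: q_1_def sin_gt_zero)
  then show ?thesis unfolding dom_1_def r by auto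
qed

lemma dom_2_eq: assumes "c \<noteq> 0" shows "dom_2 c = {..z_crit c}"
proof -
  have r: "- 1 + \<bar>c\<bar> / 2 * exp (3 * z / 2) \<in> {-1..1} \<longleftrightarrow> z \<le> z_crit c" for z
    using le_z_crit_iff(1)[OF assms, of z] by auto
  have "0 < 1 + 2 * cos (1/3 * pi + 1/3 * beta c z)" "0 < sin (1/6 * pi + 1/6 * beta c z)"
    if "z \<le> z_crit c" for z
  proof -
    show "0 < 1 + 2 * cos (1/3 * pi + 1/3 * beta c z)"
      using cubic_q_2(3)[OF assms that] by (simp add: q_2_def)
    show "0 < sin (1/6 * pi + 1/6 * beta c z)"
      using beta_props[OF assms that] by (intro sin_gt_zero) auto
  qed
  then show ?thesis unfolding dom_2_def r by auto
qed

lemma dom_31_eq: assumes "c \<noteq> 0" shows "dom_31 c = {..z_crit c}"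
proof -
  have r: "- 1 + \<bar>c\<bar> / 2 * exp (3 * z / 2) \<in> {-1..1} \<longleftrightarrow> z \<le> z_crit c" for z
    using le_z_crit_iff(1)[OF assms, of z] by auto
  have "0 < - 1 + 2 * cos (1/3 * beta c z)" "0 < cos (1/6 * beta c z)" if "z \<le> z_crit c" for z
  proof -
    show "0 < - 1 + 2 * cos (1/3 * beta c z)"
      using cubic_q_3(2)[OF assms, of z] that by (simp add: q_3_def)
    show "0 < cos (1/6 * beta c z)"
      using beta_props[OF assms that] by (intro cos_gt_zero_pi) auto
  qed
  then show ?thesis unfolding dom_31_def r by auto
qed

lemma dom_32_eq: assumes "c \<noteq> 0" shows "dom_32 c = {z_crit c..}"
proof -
  have r: "1 \<le> - 1 + \<bar>c\<bar> / 2 * exp (3 * z / 2) \<longleftrightarrow> z_crit c \<le> z" for z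
    using le_z_crit_iff(2)[OF assms, of z] by auto
  have "0 < - 1 + 2 * cosh (1/3 * t)" for t :: real
    using cosh_real_ge_1[of "1/3 * t"] by linarith
  then show ?thesis unfolding dom_32_def r by auto
qed

text \<open>With \<open>alpha\<close> equal to \<open>pi\<close> and \<open>beta\<close> equal to 0,
  the two formulas become identical; \<open>q_1\<close> and \<open>q_2\<close> meet in the double
  root - 1.\<close>

lemma v_1_v_2_z_crit:
  assumes "c \<noteq> 0" shows "v_1 b c d (z_crit c) = v_2 b c d (z_crit c)"
proof -
  have "alpha c (z_crit c) = pi" "beta c (z_crit c) = 0"
    using exp_z_crit[OF assms] assms by (simp_all add: alpha_def beta_def)
  then show ?thesis by (simp add: v_1_def v_2_def)
qed

section \<open>The exceptional solution and the linear case\<close>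

lemma F_singular_iff:
  assumes "b \<noteq> 0"
  shows "F b y p = 0 \<and> deriv (F b y) p = 0 \<longleftrightarrow> y = 1 / b \<and> p = 0"
proof -
  have "(F b y has_real_derivative 2 * y * p - 2 * (y\<^sup>2 + 1 / b * y - 2 / b\<^sup>2)) (at p)"
    unfolding F_def [abs_def] by (auto intro!: derivative_eq_intros)
  then have d: "deriv (F b y) p = 2 * y * p - 2 * (y\<^sup>2 + 1 / b * y - 2 / b\<^sup>2)"
    by (rule DERIV_imp_deriv)
  \<comment> \<open>Rescaling by \<open>b\<close> removes the parameter from both equations.\<close>
  define Y P where "Y = b * y" and "P = b * p"
  have yp: "y = Y / b" "p = P / b" using assms by (simp_all add: Y_def P_def)
  have 1: "F b y p = (Y * P\<^sup>2 - 2 * (Y\<^sup>2 + Y - 2) * P + (Y\<^sup>2 + 2 * Y - 3) * Y) / b ^ 3"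
    unfolding F_def yp using assms
    by (simp add: divide_simps power2_eq_square power3_eq_cube)
  have 2: "deriv (F b y) p = 2 * (Y * P - (Y\<^sup>2 + Y - 2)) / b\<^sup>2"
    unfolding d unfolding yp using assms by (simp add: divide_simps power2_eq_square)
  have "Y * P\<^sup>2 - 2 * (Y\<^sup>2 + Y - 2) * P + (Y\<^sup>2 + 2 * Y - 3) * Y = 0 \<and> Y * P - (Y\<^sup>2 + Y - 2) = 0
      \<longleftrightarrow> Y = 1 \<and> P = 0"
  proof
    assume h: "Y * P\<^sup>2 - 2 * (Y\<^sup>2 + Y - 2) * P + (Y\<^sup>2 + 2 * Y - 3) * Y = 0 \<and> Y * P - (Y\<^sup>2 + Y - 2) = 0"
    \<comment> \<open>The discriminant of the quadratic \<open>F b y\<close> is a multiple of \<open>Y - 1\<close>.\<close>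
    then have YP: "Y * P = Y\<^sup>2 + Y - 2" by simp
    \<comment> \<open>After multiplication by \<open>Y\<close>, the unknown \<open>P\<close> enters
      only through \<open>Y * P\<close>, which the derivative condition expresses by
      \<open>Y\<close>; no division by \<open>Y\<close> occurs.\<close>
    have "Y * (Y * P\<^sup>2 - 2 * (Y\<^sup>2 + Y - 2) * P + (Y\<^sup>2 + 2 * Y - 3) * Y) =
        (Y * P)\<^sup>2 - 2 * (Y\<^sup>2 + Y - 2) * (Y * P) + (Y\<^sup>2 + 2 * Y - 3) * Y\<^sup>2"
      by (simp add: power2_eq_square algebra_simps)
    also have "\<dots> = 4 * (Y - 1)"
      unfolding YP by (simp add: power2_eq_square algebra_simps)
    finally have "4 * (Y - 1) = 0" using h by simp
    with h show "Y = 1 \<and> P = 0" by simp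
  qed simp
  then show ?thesis
    unfolding 1 2 using assms by (auto simp: yp)
qed

lemma exceptional_solution_iff:
  assumes "b \<noteq> 0" "open I"
  shows "exceptional_solution b I y \<longleftrightarrow> (\<forall>z\<in>I. y z = 1 / b)"
proof
  assume "exceptional_solution b I y"
  then show "\<forall>z\<in>I. y z = 1 / b"
    unfolding exceptional_solution_def using F_singular_iff[OF assms(1)] by blast
next
  assume y: "\<forall>z\<in>I. y z = 1 / b"
  have y0: "(y has_real_derivative 0) (at z)" if "z \<in> I" for z
    by (rule has_field_derivative_transform_within_open[OF DERIV_const \<open>open I\<close> that, of "1 / b"])
      (use y in auto)
  have "y differentiable (at z) \<and> deriv y z = 0" if "z \<in> I" for z
    using DERIV_imp_deriv[OF y0[OF that]] y0[OF that]
    unfolding real_differentiable_def by blast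
  then show "exceptional_solution b I y"
    unfolding exceptional_solution_def using F_singular_iff[OF assms(1)] y by simp
qed

section \<open>Antiderivatives and the linear equation\<close>

lemma DERIV_eq_imp_const_diff:
  fixes f g :: "real \<Rightarrow> real"
  assumes "open_interval I"
    and "\<And>z. z \<in> I \<Longrightarrow> (f has_real_derivative h z) (at z)"
    and "\<And>z. z \<in> I \<Longrightarrow> (g has_real_derivative h z) (at z)"
  shows "\<exists>d. \<forall>z\<in>I. f z = g z + d"
proof -
  have D: "((\<lambda>z. f z - g z) has_real_derivative 0) (at z within I)" if "z \<in> I" for z
    using DERIV_subset[OF DERIV_diff[OF assms(2,3)[OF that]]] by simp
  have "convex I" using assms(1) by (simp add: open_interval_def is_interval_convex)
  from has_field_derivative_zero_constant[OF this D]
  obtain d where d: "\<And>z. z \<in> I \<Longrightarrow> f z - g z = d" by metis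
  have "f z = g z + d" if "z \<in> I" for z
    using d[OF that] by simp
  then show ?thesis by blast
qed

lemma deriv_const_iff:
  assumes "open_interval I" "\<forall>z\<in>I. v differentiable (at z)"
  shows "(\<forall>z\<in>I. deriv v z = k) \<longleftrightarrow> (\<exists>d. \<forall>z\<in>I. v z = k * z + d)"
proof
  assume h: "\<forall>z\<in>I. deriv v z = k"
  have "(v has_real_derivative k) (at z)" if "z \<in> I" for z
    using assms(2) h that DERIV_deriv_iff_real_differentiable[of v z] by simp
  moreover have "((\<lambda>z. k * z) has_real_derivative k) (at z)" if "z \<in> I" for z
    by (auto intro!: derivative_eq_intros)
  ultimately show "\<exists>d. \<forall>z\<in>I. v z = k * z + d"
    by (rule DERIV_eq_imp_const_diff[OF assms(1)])
next
  assume "\<exists>d. \<forall>z\<in>I. v z = k * z + d"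
  then obtain d where d: "\<forall>z\<in>I. v z = k * z + d" ..
  show "\<forall>z\<in>I. deriv v z = k"
  proof
    fix z assume z: "z \<in> I"
    have "((\<lambda>z. k * z + d) has_real_derivative k) (at z)" by (auto intro!: derivative_eq_intros)
    then have "(v has_real_derivative k) (at z)"
      by (rule has_field_derivative_transform_within_open[of _ _ _ I])
        (use assms(1) d z in \<open>auto simp: open_interval_def\<close>)
    then show "deriv v z = k" by (rule DERIV_imp_deriv)
  qed
qed

lemma linear_ode_iff:
  assumes "open_interval I"
  shows "solves_ode2 0 I v \<longleftrightarrow> (\<exists>d1 d2. \<forall>z\<in>I. v z = d1 + d2 * exp (3 * z / 4))"
proof
  assume s: "solves_ode2 0 I v"
  have v: "(v has_real_derivative deriv v z) (at z)"
    "(deriv v has_real_derivative 3 / 4 * deriv v z) (at z)" if "z \<in> I" for z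
  proof -
    have h: "v differentiable (at z)" "deriv v differentiable (at z)"
      "deriv v z + 4 * (deriv (deriv v) z - deriv v z) = 0"
      using s that by (auto simp: solves_ode2_def ode_lhs_def)
    then show "(v has_real_derivative deriv v z) (at z)"
      by (simp add: DERIV_deriv_iff_real_differentiable)
    have "deriv (deriv v) z = 3 / 4 * deriv v z" using h(3) by simp
    then show "(deriv v has_real_derivative 3 / 4 * deriv v z) (at z)"
      using h(2) DERIV_deriv_iff_real_differentiable[of "deriv v" z] by metis
  qed
  \<comment> \<open>The integrating factor of \<open>v'' = 3/4 v'\<close>.\<close>
  have "((\<lambda>z. deriv v z * exp (- (3 * z / 4))) has_real_derivative 0) (at z)" if "z \<in> I" for z
    using v(2)[OF that] by (auto intro!: derivative_eq_intros)
  then have "\<exists>k. \<forall>z\<in>I. deriv v z * exp (- (3 * z / 4)) = 0 + k"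
    by (rule DERIV_eq_imp_const_diff[OF assms]) auto
  then obtain k where k: "\<And>z. z \<in> I \<Longrightarrow> deriv v z * exp (- (3 * z / 4)) = k"
    by auto
  have "deriv v z = k * exp (3 * z / 4)" if "z \<in> I" for z
    using k[OF that] by (simp add: exp_minus field_simps)
  then have "(v has_real_derivative k * exp (3 * z / 4)) (at z)" if "z \<in> I" for z
    using v(1)[OF that] that by simp
  moreover have "((\<lambda>z. 4 / 3 * k * exp (3 * z / 4)) has_real_derivative k * exp (3 * z / 4)) (at z)"
    if "z \<in> I" for z
    by (auto intro!: derivative_eq_intros)
  ultimately have "\<exists>d. \<forall>z\<in>I. v z = 4 / 3 * k * exp (3 * z / 4) + d"
    by (rule DERIV_eq_imp_const_diff[OF assms])
  then show "\<exists>d1 d2. \<forall>z\<in>I. v z = d1 + d2 * exp (3 * z / 4)"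
    by (metis add.commute)
next
  assume "\<exists>d1 d2. \<forall>z\<in>I. v z = d1 + d2 * exp (3 * z / 4)"
  then obtain d1 d2 where d: "\<forall>z\<in>I. v z = d1 + d2 * exp (3 * z / 4)" by blast
  have o: "open I" using assms by (simp add: open_interval_def)
  have v: "(v has_real_derivative 3 / 4 * d2 * exp (3 * z / 4)) (at z)" if "z \<in> I" for z
  proof -
    have "((\<lambda>z. d1 + d2 * exp (3 * z / 4)) has_real_derivative 3 / 4 * d2 * exp (3 * z / 4)) (at z)"
      by (auto intro!: derivative_eq_intros)
    then show ?thesis
      by (rule has_field_derivative_transform_within_open[OF _ o that]) (use d in auto)
  qed
  then have dv: "deriv v z = 3 / 4 * d2 * exp (3 * z / 4)" if "z \<in> I" for z
    using that DERIV_imp_deriv by blast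
  have v2: "(deriv v has_real_derivative 9 / 16 * d2 * exp (3 * z / 4)) (at z)" if "z \<in> I" for z
  proof -
    have "((\<lambda>z. 3 / 4 * d2 * exp (3 * z / 4)) has_real_derivative 9 / 16 * d2 * exp (3 * z / 4)) (at z)"
      by (auto intro!: derivative_eq_intros)
    then show ?thesis
      by (rule has_field_derivative_transform_within_open[OF _ o that]) (use dv in auto)
  qed
  then have ddv: "deriv (deriv v) z = 9 / 16 * d2 * exp (3 * z / 4)" if "z \<in> I" for z
    using that DERIV_imp_deriv by blast
  show "solves_ode2 0 I v"
    unfolding solves_ode2_def
  proof (intro ballI conjI)
    fix z assume z: "z \<in> I"
    show "v differentiable (at z)" "deriv v differentiable (at z)"
      using v[OF z] v2[OF z] real_differentiable_def by blast+
    show "ode_lhs 0 (deriv v z) (deriv (deriv v) z) = 0"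
      by (simp add: ode_lhs_def dv[OF z] ddv[OF z])
  qed simp
qed

lemma linear_ode_lhs: "linear (\<lambda>(p, q). ode_lhs 0 p q)"
  by (rule linearI) (auto simp: ode_lhs_def algebra_simps)

section \<open>Lifting a solution to the parametrization\<close>

lemma darboux_upcrossing:
  fixes f f' :: "real \<Rightarrow> real"
  assumes D: "\<And>z. z \<in> {x..y} \<Longrightarrow> (f has_real_derivative f' z) (at z)"
    and "x < y" "f' x < k" "k < f' y"
  shows "\<exists>m\<in>{x..y}. f' m = k"
proof -
  \<comment> \<open>Darboux's argument: \<open>h\<close> has negative slope at the left end and
    positive slope at the right end, so its minimum is interior.\<close>
  define h where "h z = f z - k * z" for z
  have h: "(h has_real_derivative f' z - k) (at z)" if "z \<in> {x..y}" for z
    unfolding h_def [abs_def] using D[OF that] by (auto intro!: derivative_eq_intros)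
  have "continuous_on {x..y} h"
    by (meson DERIV_isCont continuous_at_imp_continuous_on h)
  then obtain m where m: "m \<in> {x..y}" "\<And>z. z \<in> {x..y} \<Longrightarrow> h m \<le> h z"
    using continuous_attains_inf[of "{x..y}" h] \<open>x < y\<close> by auto
  have "m \<noteq> x"
  proof
    assume "m = x"
    obtain d where d: "d > 0" "\<And>e. 0 < e \<Longrightarrow> e < d \<Longrightarrow> h (x + e) < h x"
      using DERIV_neg_dec_right[OF h[of x]] assms(2,3) by auto
    define e where "e = min (d / 2) (y - x)"
    have "h (x + e) < h x" using d \<open>x < y\<close> by (intro d(2)) (auto simp: e_def)
    moreover have "x + e \<in> {x..y}" using d \<open>x < y\<close> by (auto simp: e_def)
    ultimately show False using m(2)[of "x + e"] \<open>m = x\<close> by simp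
  qed
  moreover have "m \<noteq> y"
  proof
    assume "m = y"
    obtain d where d: "d > 0" "\<And>e. 0 < e \<Longrightarrow> e < d \<Longrightarrow> h (y - e) < h y"
      using DERIV_pos_inc_left[OF h[of y]] assms(2,4) by auto
    define e where "e = min (d / 2) (y - x)"
    have "h (y - e) < h y" using d \<open>x < y\<close> by (intro d(2)) (auto simp: e_def)
    moreover have "y - e \<in> {x..y}" using d \<open>x < y\<close> by (auto simp: e_def)
    ultimately show False using m(2)[of "y - e"] \<open>m = y\<close> by simp
  qed
  ultimately have i: "x < m" "m < y" using m(1) by auto
  have "f' m - k = 0"
  proof (rule DERIV_local_min[OF h[OF m(1)]])
    show "0 < min (m - x) (y - m)" using i by simp
    show "\<forall>z. \<bar>m - z\<bar> < min (m - x) (y - m) \<longrightarrow> h m \<le> h z"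
    proof (intro allI impI m(2))
      fix z assume "\<bar>m - z\<bar> < min (m - x) (y - m)"
      then have "m - z < m - x" "z - m < y - m" by linarith+
      then show "z \<in> {x..y}" by simp
    qed
  qed
  then show ?thesis using m(1) by auto
qed

lemma derivative_avoids:
  fixes f f' :: "real \<Rightarrow> real"
  assumes "is_interval S"
    and D: "\<And>z. z \<in> S \<Longrightarrow> (f has_real_derivative f' z) (at z)"
    and ne: "\<And>z. z \<in> S \<Longrightarrow> f' z \<noteq> k"
    and "x \<in> S" "y \<in> S" "f' x < k"
  shows "f' y < k"
proof (rule ccontr)
  assume "\<not> f' y < k"
  then have y: "k < f' y" using ne[OF \<open>y \<in> S\<close>] by simp
  have sub: "{x..y} \<subseteq> S" "{y..x} \<subseteq> S"
    using mem_is_interval_1_I[OF assms(1,4,5)] mem_is_interval_1_I[OF assms(1,5,4)] by auto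
  have "x \<noteq> y" using y \<open>f' x < k\<close> by auto
  then show False
  proof (cases "x < y")
    case True
    have "\<exists>m\<in>{x..y}. f' m = k"
      by (rule darboux_upcrossing[of x y f f' k]) (use D sub True y \<open>f' x < k\<close> in auto)
    then show False using ne sub by auto
  next
    case False
    \<comment> \<open>Here \<open>y\<close> lies to the left of \<open>x\<close> and the derivative
      crosses \<open>k\<close> downwards; negation makes this an upcrossing.\<close>
    have "\<exists>m\<in>{y..x}. - f' m = - k"
    proof (rule darboux_upcrossing[of y x "\<lambda>z. - f z" "\<lambda>z. - f' z" "- k"])
      show "((\<lambda>z. - f z) has_real_derivative - f' z) (at z)" if "z \<in> {y..x}" for z
        using D[of z] sub that by (intro DERIV_minus) auto
    qed (use \<open>x \<noteq> y\<close> False y \<open>f' x < k\<close> in auto)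
    then show False using ne sub by auto
  qed
qed

lemma continuous_avoids:
  fixes q :: "real \<Rightarrow> real"
  assumes "is_interval S" "continuous_on S q" "\<And>z. z \<in> S \<Longrightarrow> q z \<noteq> k"
  shows "(\<forall>z\<in>S. q z < k) \<or> (\<forall>z\<in>S. k < q z)"
proof (rule ccontr)
  assume "\<not> ?thesis"
  then obtain x y where "x \<in> S" "y \<in> S" "\<not> q x < k" "\<not> k < q y" by blast
  with assms(3)[of x] assms(3)[of y] have xy: "x \<in> S" "y \<in> S" "k < q x" "q y < k" by auto
  have "is_interval (q ` S)"
    using assms(1,2) by (simp add: connected_continuous_image is_interval_connected_1)
  moreover have "q x \<in> q ` S" "q y \<in> q ` S" using xy by auto
  ultimately have "k \<in> q ` S"
    unfolding is_interval_1 using less_imp_le[OF xy(3)] less_imp_le[OF xy(4)] by blast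
  then show False using assms(3) by auto
qed

text \<open>The derivative of \<open>q\<close> is prescribed only off its zeros: where a line is
  glued to an arc of \<open>v_2\<close>, the one-sided slopes of \<open>q\<close> are 0 and
  \<open>flow 0 = - 1\<close>. The formula for \<open>v''\<close> holds at the zeros too and later
  supplies information on the slope there.\<close>

definition lifts :: "real \<Rightarrow> real set \<Rightarrow> (real \<Rightarrow> real) \<Rightarrow> (real \<Rightarrow> real) \<Rightarrow> bool" where
  "lifts b I v q \<longleftrightarrow> continuous_on I q \<and> (\<forall>z\<in>I. q z \<noteq> - 1 \<and>
     (v has_real_derivative (1 - (q z)\<^sup>2) / b) (at z) \<and>
     (deriv v has_real_derivative - 2 * (q z * flow (q z)) / b) (at z) \<and>
     (q z \<noteq> 0 \<longrightarrow> (q has_real_derivative flow (q z)) (at z)))"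

lemma ode_parametrization:
  assumes "b \<noteq> 0" "1 - b * (r - p) \<noteq> 0" "ode_lhs b p r = 0"
  defines "s \<equiv> 1 - b * (r - p)"
  defines "q \<equiv> 2 / s - 1"
  shows "q \<noteq> - 1" "p = (1 - q\<^sup>2) / b" "r = - 2 * (q * flow q) / b"
proof -
  have s0: "s \<noteq> 0" using assms(2) by (simp add: s_def)
  then show q: "q \<noteq> - 1" by (simp add: q_def)
  then have q': "q + 1 \<noteq> 0" by linarith
  have s: "s = 2 / (q + 1)" using s0 by (simp add: q_def)
  have rp: "b * (r - p) = 1 - s" by (simp add: s_def)
  have "b * (p + 4 * ((r - p) / s\<^sup>2)) = 0"
    using assms(3) by (simp add: ode_lhs_def s_def)
  then have "b * p + 4 * (b * (r - p)) / s\<^sup>2 = 0" by (simp add: distrib_left mult.left_commute)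
  then have "b * p = - (4 * (1 - s) / s\<^sup>2)" unfolding rp by linarith
  also have "\<dots> = 1 - q\<^sup>2"
    unfolding s using q' by (simp add: divide_simps power2_eq_square) algebra
  finally have bp: "b * p = 1 - q\<^sup>2" .
  then show "p = (1 - q\<^sup>2) / b" using assms(1) by (simp add: field_simps)
  have "b * r = b * p + (1 - s)" using rp by (simp add: algebra_simps)
  also have "\<dots> = - 2 * (q * flow q)"
    unfolding bp s flow_def using q' by (simp add: divide_simps power2_eq_square) algebra
  finally show "r = - 2 * (q * flow q) / b" using assms(1) by (simp add: field_simps)
qed

text \<open>Continuity fixes the sign of \<open>q\<close> near a nonzero value, so \<open>q\<close>
  is locally a signed square root of a function differentiable at \<open>z\<close>.\<close>

lemma DERIV_sqrt_branch:
  fixes q :: "real \<Rightarrow> real"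
  assumes "open I" "continuous_on I q" "z \<in> I" "q z \<noteq> 0"
    and D: "((\<lambda>z. (q z)\<^sup>2) has_real_derivative 2 * (q z * d)) (at z)"
  shows "(q has_real_derivative d) (at z)"
proof -
  define U where "U = I \<inter> (\<lambda>w. q w * q z) -` {0<..}"
  have U: "open U" unfolding U_def
    using assms(1,2) by (intro continuous_open_preimage continuous_intros) auto
  have "z \<in> U" using assms(3,4) by (auto simp: U_def not_square_less_zero less_le)
  have eq: "q w = sgn (q z) * sqrt ((q w)\<^sup>2)" if "w \<in> U" for w
    using that by (auto simp: U_def zero_less_mult_iff)
  have "(q z)\<^sup>2 > 0" using assms(4) by simp
  from DERIV_cmult[OF DERIV_chain2[OF DERIV_real_sqrt[OF this] D], of "sgn (q z)"]
  have "((\<lambda>w. sgn (q z) * sqrt ((q w)\<^sup>2)) has_real_derivative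
      sgn (q z) * (inverse (sqrt ((q z)\<^sup>2)) / 2 * (2 * (q z * d)))) (at z)" .
  moreover have "sgn (q z) * (inverse (sqrt ((q z)\<^sup>2)) / 2 * (2 * (q z * d))) = d"
    using assms(4) by (cases "q z > 0") (simp_all add: field_simps)
  ultimately have "((\<lambda>w. sgn (q z) * sqrt ((q w)\<^sup>2)) has_real_derivative d) (at z)"
    by (simp only:)
  then show ?thesis
    by (rule has_field_derivative_transform_within_open[OF _ U \<open>z \<in> U\<close>]) (rule eq[symmetric])
qed

text \<open>The absolute value of \<open>q\<close> is continuous, so only a jump of sign can break
  continuity. The condition \<open>sign\<close> forbids it on intervals without zeros, and at a zero
  the absolute value alone decides.\<close>

lemma continuous_if_square_continuous:
  fixes q :: "real \<Rightarrow> real"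
  assumes "open I" "continuous_on I (\<lambda>z. (q z)\<^sup>2)"
    and sign: "\<And>S x y. S \<subseteq> I \<Longrightarrow> is_interval S \<Longrightarrow> (\<And>z. z \<in> S \<Longrightarrow> q z \<noteq> 0) \<Longrightarrow>
      x \<in> S \<Longrightarrow> y \<in> S \<Longrightarrow> 0 < q x \<Longrightarrow> 0 < q y"
  shows "continuous_on I q"
proof -
  have "isCont q z" if z: "z \<in> I" for z
  proof (cases "q z = 0")
    case True
    have "isCont (\<lambda>z. (q z)\<^sup>2) z"
      using assms(1,2) z by (simp add: continuous_on_eq_continuous_at)
    then have "isCont (\<lambda>z. sqrt ((q z)\<^sup>2)) z" by (rule continuous_real_sqrt)
    then have "isCont (\<lambda>z. \<bar>q z\<bar>) z" by simp
    then show ?thesis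
      using True by (simp add: isCont_def tendsto_rabs_zero_iff)
  next
    case False
    define U where "U = I \<inter> (\<lambda>w. (q w)\<^sup>2) -` {0<..}"
    have "open U" unfolding U_def using assms(1,2) by (intro continuous_open_preimage) auto
    moreover have "z \<in> U" using z False by (simp add: U_def)
    ultimately obtain e where e: "e > 0" "ball z e \<subseteq> U" by (metis open_contains_ball)
    have B: "ball z e \<subseteq> I" "\<And>w. w \<in> ball z e \<Longrightarrow> q w \<noteq> 0" "z \<in> ball z e" "is_interval (ball z e)"
      using e by (auto simp: U_def is_interval_ball_real)
    have eq: "q w = sgn (q z) * sqrt ((q w)\<^sup>2)" if "w \<in> ball z e" for w
    proof (cases "q z > 0")
      case True
      then show ?thesis using sign[OF B(1,4,2) B(3) that] by simp
    next
      case F: False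
      then have "\<not> q w > 0" using sign[OF B(1,4,2) that B(3)] by blast
      then show ?thesis using F False B(2)[OF that] by simp
    qed
    have "continuous_on (ball z e) (\<lambda>w. sgn (q z) * sqrt ((q w)\<^sup>2))"
      by (intro continuous_on_mult_left continuous_on_real_sqrt continuous_on_subset[OF assms(2) B(1)])
    then have "continuous_on (ball z e) q"
      by (rule continuous_on_eq) (rule eq[symmetric])
    then show ?thesis using B(3) by (simp add: continuous_on_eq_continuous_at)
  qed
  then show ?thesis by (simp add: continuous_at_imp_continuous_on)
qed

text \<open>The denominator of the equation is itself a derivative, so it has the intermediate value
  property although \<open>deriv (deriv v)\<close> is not known to be continuous; this makes \<open>q\<close> continuous.\<close>

lemma solves_ode2_lifts:
  assumes "b \<noteq> 0" "open_interval I" "solves_ode2 b I v"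
  shows "\<exists>q. lifts b I v q"
proof -
  have I: "open I" "is_interval I" using assms(2) by (auto simp: open_interval_def)
  define s where "s z = 1 - b * (deriv (deriv v) z - deriv v z)" for z
  define q where "q z = 2 / s z - 1" for z
  have v: "(v has_real_derivative deriv v z) (at z)"
    "(deriv v has_real_derivative deriv (deriv v) z) (at z)" if "z \<in> I" for z
    using assms(3) that
    by (simp_all add: solves_ode2_def DERIV_deriv_iff_real_differentiable)
  have q: "q z \<noteq> - 1" "deriv v z = (1 - (q z)\<^sup>2) / b"
    "deriv (deriv v) z = - 2 * (q z * flow (q z)) / b" "s z \<noteq> 0" if "z \<in> I" for z
  proof -
    have h: "1 - b * (deriv (deriv v) z - deriv v z) \<noteq> 0"
      "ode_lhs b (deriv v z) (deriv (deriv v) z) = 0"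
      using assms(3) that by (auto simp: solves_ode2_def)
    then show "s z \<noteq> 0" by (simp add: s_def)
    show "q z \<noteq> - 1" "deriv v z = (1 - (q z)\<^sup>2) / b"
      "deriv (deriv v) z = - 2 * (q z * flow (q z)) / b"
      using ode_parametrization[OF assms(1) h] by (simp_all add: q_def s_def)
  qed
  have sD: "((\<lambda>z. z - b * deriv v z + b * v z) has_real_derivative s z) (at z)" if "z \<in> I" for z
    using v[OF that] by (auto intro!: derivative_eq_intros simp: s_def algebra_simps)
  have q2: "(q z)\<^sup>2 = 1 - b * deriv v z" if "z \<in> I" for z
    using q(2)[OF that] assms(1) by simp
  have cont: "continuous_on I q"
  proof (rule continuous_if_square_continuous[OF I(1)])
    have "continuous_on I (deriv v)"
      using v(2) by (meson DERIV_isCont continuous_at_imp_continuous_on)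
    then have "continuous_on I (\<lambda>z. 1 - b * deriv v z)" by (intro continuous_intros)
    then show "continuous_on I (\<lambda>z. (q z)\<^sup>2)"
      by (rule continuous_on_eq) (simp add: q2)
  next
    fix S x y
    assume S: "S \<subseteq> I" "is_interval S" "\<And>z. z \<in> S \<Longrightarrow> q z \<noteq> 0" "x \<in> S" "y \<in> S" "0 < q x"
    \<comment> \<open>\<open>0 < q\<close> means \<open>0 < s < 2\<close>. An interval without zeros
      of \<open>q\<close> avoids the level 2, and the denominator never takes the value 0, so by the
      Darboux property \<open>s\<close> stays in this strip.\<close>
    have s2: "s z \<noteq> 2" if "z \<in> S" for z using S(3)[OF that] by (auto simp: q_def)
    have "0 < s x" "s x < 2"
      using S(6) q(4)[of x] S(1,4)
      by (auto simp: q_def less_divide_eq split: if_splits)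
    have "s y < 2"
      using derivative_avoids[OF S(2) sD s2 S(4,5) \<open>s x < 2\<close>] S(1) by blast
    moreover have "\<not> s y < 0"
      using derivative_avoids[OF I(2) sD q(4), of y x] S(1,4,5) \<open>0 < s x\<close> by auto
    ultimately show "0 < q y" using q(4)[of y] S(1,5) by (auto simp: q_def less_divide_eq)
  qed
  have "(q has_real_derivative flow (q z)) (at z)" if "z \<in> I" "q z \<noteq> 0" for z
  proof (rule DERIV_sqrt_branch[OF I(1) cont that])
    have "((\<lambda>z. 1 - b * deriv v z) has_real_derivative - (b * deriv (deriv v) z)) (at z)"
      using v(2)[OF that(1)] by (auto intro!: derivative_eq_intros)
    moreover have "- (b * deriv (deriv v) z) = 2 * (q z * flow (q z))"
      using q(3)[OF that(1)] assms(1) by simp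
    ultimately have "((\<lambda>z. 1 - b * deriv v z) has_real_derivative 2 * (q z * flow (q z))) (at z)"
      by simp
    then show "((\<lambda>z. (q z)\<^sup>2) has_real_derivative 2 * (q z * flow (q z))) (at z)"
      by (rule has_field_derivative_transform_within_open[OF _ I(1) that(1)]) (simp add: q2)
  qed
  moreover have "(v has_real_derivative (1 - (q z)\<^sup>2) / b) (at z)"
    "(deriv v has_real_derivative - 2 * (q z * flow (q z)) / b) (at z)" if "z \<in> I" for z
    using v(1)[OF that, unfolded q(2)[OF that]] v(2)[OF that, unfolded q(3)[OF that]] .
  ultimately have "lifts b I v q"
    unfolding lifts_def using cont q(1) by simp
  then show ?thesis by blast
qed

section \<open>Zeros of the lift\<close>

lemma lifts_subset: "lifts b I v q \<Longrightarrow> K \<subseteq> I \<Longrightarrow> lifts b K v q"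
  unfolding lifts_def by (auto intro: continuous_on_subset)

lemma closed_segment_subset_interval:
  fixes x y :: real
  assumes "is_interval S" "x \<in> S" "y \<in> S" shows "closed_segment x y \<subseteq> S"
  using assms by (simp add: closed_segment_subset is_interval_convex)

lemma DERIV_first_integral:
  assumes "(q has_real_derivative flow (q z)) (at z)" "q z \<noteq> - 1"
  shows "((\<lambda>z. cubic (q z) * exp (- (3 * z / 2))) has_real_derivative 0) (at z)"
proof -
  have n: "q z + 1 \<noteq> 0" using assms(2) by simp
  have "((\<lambda>z. cubic (q z) * exp (- (3 * z / 2))) has_real_derivative
      3 * ((q z)\<^sup>2 - 1) * flow (q z) * exp (- (3 * z / 2)) +
      (exp (- (3 * z / 2)) * - (3 / 2)) * cubic (q z)) (at z)"
    by (rule DERIV_mult[OF DERIV_chain2[OF DERIV_cubic assms(1)]])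
      (auto intro!: derivative_eq_intros)
  moreover have "3 * ((q z)\<^sup>2 - 1) * flow (q z) = 3 / 2 * cubic (q z)"
    using n unfolding cubic_factor flow_def by (simp add: divide_simps power2_eq_square) algebra
  moreover have "(3 / 2 * k) * x + (x * - (3 / 2)) * k = 0" for k x :: real by simp
  ultimately show ?thesis by (simp only:)
qed

lemma continuous_on_cubic:
  assumes "continuous_on S q" shows "continuous_on S (\<lambda>z. cubic (q z))"
  unfolding cubic_def by (intro continuous_intros assms)

text \<open>At a zero of \<open>q\<close> its derivative is unknown, but continuity carries the
  constant across finitely many such points.\<close>

lemma first_integral:
  assumes "lifts b K v q" "open_interval K" "finite {z \<in> K. q z = 0}"
  shows "\<exists>C. \<forall>z\<in>K. cubic (q z) = C * exp (3 * z / 2)"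
proof -
  have K: "open K" "connected K"
    using assms(2) by (auto simp: open_interval_def is_interval_connected)
  have "continuous_on K (\<lambda>z. cubic (q z) * exp (- (3 * z / 2)))"
    using assms(1) unfolding lifts_def by (intro continuous_intros continuous_on_cubic) auto
  moreover have "\<forall>z\<in>K - {z \<in> K. q z = 0}.
      ((\<lambda>z. cubic (q z) * exp (- (3 * z / 2))) has_real_derivative 0) (at z)"
    using assms(1) unfolding lifts_def by (auto intro!: DERIV_first_integral)
  ultimately have "(\<lambda>z. cubic (q z) * exp (- (3 * z / 2))) constant_on K"
    by (intro DERIV_zero_connected_constant_on[OF K(2,1) assms(3)])
  then obtain C where C: "\<And>z. z \<in> K \<Longrightarrow> cubic (q z) * exp (- (3 * z / 2)) = C"
    unfolding constant_on_def by blast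
  have "cubic (q z) = C * exp (3 * z / 2)" if "z \<in> K" for z
    using C[OF that] by (simp add: exp_minus field_simps)
  then show ?thesis by blast
qed

text \<open>The factor 2 is \<open>cubic 0\<close>, the value at the zero \<open>t\<close>;
  constancy asks for the derivative only in the open segment, where \<open>q\<close> has no zero.
  The unordered \<open>closed_segment t c\<close> treats arcs on either side of \<open>t\<close>
  alike.\<close>

lemma first_integral_segment:
  assumes "lifts b I v q" "closed_segment t c \<subseteq> I" "t \<noteq> c"
    and "q t = 0" "\<And>x. x \<in> closed_segment t c \<Longrightarrow> q x = 0 \<Longrightarrow> x = t"
    and "x \<in> closed_segment t c"
  shows "cubic (q x) = 2 * exp (3 * (x - t) / 2)"
proof -
  define m n where "m = min t c" and "n = max t c"
  have seg: "closed_segment t c = {m..n}"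
    by (auto simp: closed_segment_eq_real_ivl m_def n_def)
  have mn: "m < n" "t = m \<or> t = n" using assms(3) by (auto simp: m_def n_def)
  define H where "H z = cubic (q z) * exp (- (3 * z / 2))" for z
  have H: "H z = H m" if "z \<in> {m..n}" for z
  proof (rule DERIV_isconst2[OF mn(1)])
    have "continuous_on {m..n} q"
      using assms(1,2) seg unfolding lifts_def by (metis continuous_on_subset)
    then show "continuous_on {m..n} H"
      unfolding H_def [abs_def] by (intro continuous_intros continuous_on_cubic) auto
    show "(H has_real_derivative 0) (at y)" if y: "m < y" "y < n" for y
    proof -
      have "y \<in> closed_segment t c" using y seg by simp
      then have "y \<in> I" "q y \<noteq> 0" using assms(2) assms(5)[of y] y mn(2) by auto
      then show ?thesis
        using assms(1) unfolding lifts_def H_def [abs_def] by (auto intro!: DERIV_first_integral)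
    qed
  qed (use that in auto)
  have "H x = H t" using H[of x] H[of t] assms(6) mn by (auto simp: seg)
  then have "cubic (q x) * exp (- (3 * x / 2)) = 2 * exp (- (3 * t / 2))"
    by (simp add: H_def \<open>q t = 0\<close> cubic_def)
  then have "cubic (q x) = 2 * (exp (- (3 * t / 2)) * exp (3 * x / 2))"
    by (simp add: exp_minus field_simps)
  also have "exp (- (3 * t / 2)) * exp (3 * x / 2) = exp (3 * (x - t) / 2)"
    by (simp add: diff_divide_distrib right_diff_distrib flip: exp_add)
  finally show ?thesis .
qed

text \<open>The zeros in the segment form a nonempty closed set, so one of them is nearest to
  \<open>c\<close>.\<close>

lemma last_zero:
  fixes q :: "real \<Rightarrow> real"
  assumes "continuous_on (closed_segment a c) q" "q a = 0" "q c \<noteq> 0"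
  shows "\<exists>t\<in>closed_segment a c. q t = 0 \<and> t \<noteq> c \<and> (\<forall>x\<in>closed_segment t c. q x = 0 \<longrightarrow> x = t)"
proof -
  define Z where "Z = closed_segment a c \<inter> q -` {0}"
  have "closed Z" unfolding Z_def
    by (intro continuous_closed_preimage assms(1)) auto
  moreover have "Z \<noteq> {}" using assms(2) by (auto simp: Z_def)
  ultimately obtain t where t: "t \<in> Z" "\<forall>y\<in>Z. dist c t \<le> dist c y"
    by (rule distance_attains_inf[of Z c]) blast
  have t': "t \<in> closed_segment a c" "q t = 0" using t(1) by (auto simp: Z_def)
  have "x = t" if "x \<in> closed_segment t c" "q x = 0" for x
  proof -
    have "x \<in> closed_segment a c"
      using that(1) t'(1) by (auto simp: closed_segment_eq_real_ivl split: if_splits)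
    then have "dist c t \<le> dist c x" using t(2) that(2) by (auto simp: Z_def)
    then show "x = t"
      using that(1) by (auto simp: closed_segment_eq_real_ivl dist_real_def split: if_splits)
  qed
  moreover have "t \<noteq> c" using t'(2) assms(3) by auto
  ultimately show ?thesis using t' by blast
qed

lemma lifts_zero_edge:
  assumes "lifts b I v q" "is_interval I" "a \<in> I" "c \<in> I" "q a = 0" "q c \<noteq> 0"
  shows "\<exists>t\<in>closed_segment a c. q t = 0 \<and> t \<noteq> c \<and>
    (\<forall>x\<in>closed_segment t c. (q x = 0 \<longrightarrow> x = t) \<and> cubic (q x) = 2 * exp (3 * (x - t) / 2))"
proof -
  have sub: "closed_segment a c \<subseteq> I" by (rule closed_segment_subset_interval[OF assms(2-4)])
  have "continuous_on (closed_segment a c) q"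
    using assms(1) sub unfolding lifts_def by (metis continuous_on_subset)
  from last_zero[OF this assms(5,6)] obtain t where t: "t \<in> closed_segment a c" "q t = 0" "t \<noteq> c"
    "\<forall>x\<in>closed_segment t c. q x = 0 \<longrightarrow> x = t" by blast
  have "closed_segment t c \<subseteq> I"
    using t(1) sub assms(2,4) by (intro closed_segment_subset_interval) auto
  from first_integral_segment[OF assms(1) this t(3,2)] t show ?thesis by blast
qed

text \<open>A lift can cross zero only downwards: leaving zero upwards to the right, the first integral
  would force it above \<open>1\<close>, through the equilibrium \<open>1\<close>; symmetrically to the left it would have
  to pass the singular value \<open>- 1\<close>.\<close>

lemma lifts_crosses_down:
  assumes "lifts b I v q" "is_interval I" "a \<in> I" "c \<in> I" "q a = 0"
  shows "q c * (c - a) \<le> 0"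
proof (rule ccontr)
  assume pos: "\<not> ?thesis"
  then have "q c \<noteq> 0" by auto
  from lifts_zero_edge[OF assms this]
  obtain t where t: "t \<in> closed_segment a c" "q t = 0" "t \<noteq> c"
    "\<And>x. x \<in> closed_segment t c \<Longrightarrow> cubic (q x) = 2 * exp (3 * (x - t) / 2)"
    by blast
  have "t \<in> I" using closed_segment_subset_interval[OF assms(2-4)] t(1) by blast
  have sub: "closed_segment t c \<subseteq> I"
    by (rule closed_segment_subset_interval[OF assms(2) \<open>t \<in> I\<close> assms(4)])
  have cont: "continuous_on (closed_segment t c) q"
    using assms(1) sub unfolding lifts_def by (metis continuous_on_subset)
  have E: "cubic (q c) = 2 * exp (3 * (c - t) / 2)" using t(4) by simp
  have int: "is_interval (closed_segment t c)"
    by (simp add: is_interval_convex_1)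
  from pos consider "a < c" "q c > 0" | "c < a" "q c < 0"
    by (force simp: not_le zero_less_mult_iff)
  then show False
  proof cases
    case 1
    then have "t < c" using t(1,3) by (auto simp: closed_segment_eq_real_ivl)
    then have "2 < cubic (q c)" unfolding E by simp
    \<comment> \<open>\<open>cubic q - 2\<close> is \<open>q (q^2 - 3)\<close>: with
      \<open>q > 0\<close> this forces \<open>q^2 > 3\<close>, hence a value beyond 1. But 1 is a
      zero of the cubic, which is positive on the whole segment.\<close>
    then have "0 < q c * ((q c)\<^sup>2 - 3)"
      by (simp add: cubic_def power2_eq_square power3_eq_cube algebra_simps)
    then have "1\<^sup>2 < (q c)\<^sup>2" using 1(2) by (simp add: zero_less_mult_iff)
    then have "1 < q c" using 1(2) by (intro power2_less_imp_less[of 1 "q c"]) auto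
    moreover have "q x \<noteq> 1" if "x \<in> closed_segment t c" for x
      using t(4)[OF that] by (auto simp: cubic_def)
    ultimately have "1 < q t"
      using continuous_avoids[OF int cont, of 1] by force
    then show False using t(2) by simp
  next
    case 2
    then have "c < t" using t(1,3) by (auto simp: closed_segment_eq_real_ivl)
    then have "cubic (q c) < 2" unfolding E by simp
    \<comment> \<open>The mirror case: again \<open>q^2 > 3\<close>, now beyond the forbidden value
      - 1.\<close>
    then have "q c * ((q c)\<^sup>2 - 3) < 0"
      by (simp add: cubic_def power2_eq_square power3_eq_cube algebra_simps)
    then have "1\<^sup>2 < (- q c)\<^sup>2" using 2(2) by (simp add: mult_less_0_iff)
    then have "1 < - q c" using 2(2) by (intro power2_less_imp_less[of 1 "- q c"]) auto
    moreover have "q x \<noteq> - 1" if "x \<in> closed_segment t c" for x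
      using assms(1) sub that unfolding lifts_def by blast
    ultimately have "q t < - 1"
      using continuous_avoids[OF int cont, of "- 1"] by force
    then show False using t(2) by simp
  qed
qed

text \<open>Seen from the zero on the left the lift is at most 0, seen from the zero on the right it
  is at least 0.\<close>

lemma lifts_zeros_convex:
  assumes "lifts b I v q" "is_interval I" "x \<in> I" "y \<in> I" "q x = 0" "q y = 0" "x \<le> z" "z \<le> y"
  shows "q z = 0"
proof (cases "z = x \<or> z = y")
  case False
  have "z \<in> I" using mem_is_interval_1_I[OF assms(2-4,7,8)] .
  then have "q z * (z - x) \<le> 0" "q z * (z - y) \<le> 0"
    using lifts_crosses_down[OF assms(1,2)] assms by auto
  then show ?thesis using False assms(7,8) by (auto simp: mult_le_0_iff)
qed (use assms in auto)

section \<open>One-sided slopes at the ends of the zero set\<close>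

lemma DERIV_unique_segment:
  fixes f g :: "real \<Rightarrow> real"
  assumes "(f has_real_derivative D) (at t)" "(g has_real_derivative E) (at t)" "t \<noteq> a"
    and "\<And>x. x \<in> closed_segment t a \<Longrightarrow> f x = g x"
  shows "D = E"
proof -
  define m n where "m = min t a" and "n = max t a"
  have seg: "closed_segment t a = {m..n}"
    by (auto simp: closed_segment_eq_real_ivl m_def n_def)
  have mn: "m < n" "t \<in> {m..n}" using assms(3) by (auto simp: m_def n_def)
  have "(g has_real_derivative E) (at t within {m..n})"
    using assms(2) by (rule has_field_derivative_at_within)
  then have "(f has_real_derivative E) (at t within {m..n})"
    by (rule has_field_derivative_transform_within[OF _ zero_less_one mn(2)])
      (use assms(4) seg in auto)
  moreover have "(f has_real_derivative D) (at t within {m..n})"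
    using assms(1) by (rule has_field_derivative_at_within)
  ultimately show ?thesis
    using vector_derivative_unique_within_closed_interval[of m n t f D E] mn
    by (simp add: has_real_derivative_iff_has_vector_derivative)
qed

text \<open>\<open>g\<close> is a multiple of \<open>v''\<close> and hence differentiable at
  \<open>t\<close>. As \<open>q\<close> and \<open>g\<close> both vanish at \<open>t\<close>, the
  difference quotient of \<open>q\<close> is that of \<open>g\<close> times \<open>k (q z)\<close>,
  where \<open>k\<close> is the reciprocal of \<open>flow\<close>, continuous near
  \<open>q = 0\<close> because \<open>flow 0 = - 1\<close>.\<close>

lemma lifts_DERIV_at_zero:
  assumes "b \<noteq> 0" "open I" "lifts b I v q" "t \<in> I" "q t = 0"
    and "deriv (deriv v) differentiable (at t)"
  obtains D where "(q has_real_derivative D) (at t)"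
proof -
  define g where "g z = q z * flow (q z)" for z
  have cont: "isCont q t"
    using assms(2-4) unfolding lifts_def by (simp add: continuous_on_eq_continuous_at)
  have dd: "deriv (deriv v) z = - 2 * g z / b" if "z \<in> I" for z
    using assms(3) that DERIV_imp_deriv unfolding lifts_def g_def by blast
  obtain G where "(deriv (deriv v) has_real_derivative G) (at t)"
    using assms(6) real_differentiable_def by blast
  then have "((\<lambda>z. - (b / 2) * deriv (deriv v) z) has_real_derivative - (b / 2) * G) (at t)"
    by (rule DERIV_cmult)
  then have "(g has_real_derivative - (b / 2) * G) (at t)"
    by (rule has_field_derivative_transform_within_open[OF _ assms(2,4)])
      (use assms(1) in \<open>simp add: dd\<close>)
  then have lim: "((\<lambda>z. (g z - g t) / (z - t)) \<longlongrightarrow> - (b / 2) * G) (at t)"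
    by (simp add: has_field_derivative_iff)
  define k where "k y = 2 * (y + 1) / ((y - 1) * (y + 2))" for y :: real
  have "isCont (\<lambda>z. k (q z)) t"
    unfolding k_def using cont assms(5) by (intro continuous_intros) auto
  then have "((\<lambda>z. k (q z)) \<longlongrightarrow> k (q t)) (at t)" by (simp add: isCont_def)
  from tendsto_mult[OF lim this]
  have "((\<lambda>z. (g z - g t) / (z - t) * k (q z)) \<longlongrightarrow> - (b / 2) * G * k (q t)) (at t)" .
  moreover have "eventually (\<lambda>z. (g z - g t) / (z - t) * k (q z) = (q z - q t) / (z - t)) (at t)"
  proof -
    have q0: "(q \<longlongrightarrow> 0) (at t)" using cont assms(5) by (simp add: isCont_def)
    have "eventually (\<lambda>z. q z < 1) (at t)" "eventually (\<lambda>z. - 1 < q z) (at t)"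
      using order_tendstoD[OF q0] by auto
    then show ?thesis
    proof eventually_elim
      case (elim z)
      have "flow (q z) * k (q z) = 1"
      proof -
        have "q z - 1 \<noteq> 0" "q z + 2 \<noteq> 0" "q z + 1 \<noteq> 0" using elim by auto
        then show ?thesis unfolding flow_def k_def by simp
      qed
      then have "g z * k (q z) = q z" by (simp add: g_def mult.assoc)
      moreover have "g t = 0" by (simp add: g_def assms(5))
      ultimately show ?case by (simp add: assms(5))
    qed
  qed
  ultimately have "((\<lambda>z. (q z - q t) / (z - t)) \<longlongrightarrow> - (b / 2) * G * k (q t)) (at t)"
    by (rule Lim_transform_eventually)
  then show ?thesis using that by (simp add: has_field_derivative_iff)
qed

lemma lifts_zeros_dichotomy:
  assumes "b \<noteq> 0" "open_interval I" "lifts b I v q"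
    and d3: "\<And>z. z \<in> I \<Longrightarrow> deriv (deriv v) differentiable (at z)"
  shows "(\<forall>z\<in>I. q z = 0) \<or> finite {z \<in> I. q z = 0}"
proof (rule ccontr)
  have I: "open I" "is_interval I" using assms(2) by (auto simp: open_interval_def)
  assume neg: "\<not> ?thesis"
  then obtain c where c: "c \<in> I" "q c \<noteq> 0" by blast
  define Z where "Z = {z \<in> I. q z = 0}"
  have inf: "infinite Z" using neg by (simp add: Z_def)
  then obtain x0 where x0: "x0 \<in> Z" by (metis equals0I finite.emptyI)
  have "infinite (Z - {x0})" using inf by simp
  then obtain y0 where y0: "y0 \<in> Z" "y0 \<noteq> x0" by (metis DiffE equals0I finite.emptyI insertCI)
  define x y where "x = min x0 y0" and "y = max x0 y0"
  have xy: "x < y" "x \<in> Z" "y \<in> Z"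
    using x0 y0 by (auto simp: x_def y_def min_def max_def)
  have Z: "z \<in> Z" if "z1 \<in> Z" "z2 \<in> Z" "z1 \<le> z" "z \<le> z2" for z z1 z2
    using that lifts_zeros_convex[OF assms(3) I(2), of z1 z2 z] mem_is_interval_1_I[OF I(2)]
    by (auto simp: Z_def)
  have "c < x \<or> y < c" using Z[OF xy(2,3), of c] c by (force simp: Z_def)
  then have "x \<in> closed_segment y c \<or> y \<in> closed_segment x c"
    using xy(1) by (auto simp: closed_segment_eq_real_ivl)
  \<comment> \<open>Two zeros with \<open>e\<close> between \<open>a\<close> and \<open>c\<close>:
    the last zero \<open>t\<close> on the way from \<open>e\<close> to \<open>c\<close> then differs
    from \<open>a\<close>, and by convexity \<open>q\<close> vanishes all the way from
    \<open>a\<close> to \<open>t\<close>.\<close>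
  then obtain e a where ea: "e \<in> Z" "a \<in> Z" "a \<noteq> e" "e \<in> closed_segment a c"
    using xy by (metis less_irrefl)
  have ea': "e \<in> I" "a \<in> I" "q e = 0" "q a = 0" using ea by (auto simp: Z_def)
  obtain t where t: "t \<in> closed_segment e c" "q t = 0" "t \<noteq> c"
    "\<And>x. x \<in> closed_segment t c \<Longrightarrow> cubic (q x) = 2 * exp (3 * (x - t) / 2)"
    using lifts_zero_edge[OF assms(3) I(2) ea'(1) c(1) ea'(3) c(2)] by blast
  have tI: "t \<in> I" using closed_segment_subset_interval[OF I(2) ea'(1) c(1)] t(1) by blast
  obtain D where D: "(q has_real_derivative D) (at t)"
    by (rule lifts_DERIV_at_zero[OF assms(1) I(1) assms(3) tI t(2) d3[OF tI]])
  have "t \<noteq> a" using t(1) ea(3,4) by (auto simp: closed_segment_eq_real_ivl split: if_splits)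
  have "D = 0"
  proof (rule DERIV_unique_segment[OF D DERIV_const \<open>t \<noteq> a\<close>])
    fix z assume "z \<in> closed_segment t a"
    moreover have "t \<in> Z" using tI t(2) by (simp add: Z_def)
    ultimately have "z \<in> Z"
      using Z[of t a z] Z[of a t z] ea(2) by (auto simp: closed_segment_eq_real_ivl split: if_splits)
    then show "q z = 0" by (simp add: Z_def)
  qed
  \<comment> \<open>Towards \<open>c\<close> the right-hand side of the cubic relation has slope 3
    at \<open>t\<close>, which gives \<open>D = - 1\<close> against \<open>D = 0\<close> from the
    other side.\<close>
  moreover have "3 * ((q t)\<^sup>2 - 1) * D = 3"
  proof (rule DERIV_unique_segment[OF DERIV_chain2[OF DERIV_cubic D] _ t(3) t(4)])
    show "((\<lambda>x. 2 * exp (3 * (x - t) / 2)) has_real_derivative 3) (at t)"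
      by (auto intro!: derivative_eq_intros)
  qed
  ultimately show False by simp
qed

section \<open>Classification of solutions\<close>

lemma listed_onI:
  assumes "(J, f) \<in> solution_family b" "I \<subseteq> J" "\<And>z. z \<in> I \<Longrightarrow> v z = f z"
  shows "listed_on b I v"
  using assms unfolding listed_on_def by blast

lemma listed_on_constant_lift:
  assumes "b \<noteq> 0" "open_interval K" "lifts b K v q"
    and "\<And>z. z \<in> K \<Longrightarrow> q z = p" "p = 0 \<or> p = 1 \<or> p = - 2"
  shows "listed_on b K v"
proof -
  have "(v has_real_derivative (1 - p\<^sup>2) / b) (at z)" if "z \<in> K" for z
    using assms(3) assms(4)[OF that] that unfolding lifts_def by metis
  moreover have "((\<lambda>z. (1 - p\<^sup>2) / b * z) has_real_derivative (1 - p\<^sup>2) / b) (at z)"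
    if "z \<in> K" for z
    using assms(1) by (auto intro!: derivative_eq_intros)
  ultimately have "\<exists>d. \<forall>z\<in>K. v z = (1 - p\<^sup>2) / b * z + d"
    by (rule DERIV_eq_imp_const_diff[OF assms(2)])
  then obtain d where d: "\<And>z. z \<in> K \<Longrightarrow> v z = (1 - p\<^sup>2) / b * z + d" by blast
  have "(UNIV, \<lambda>z. (1 - p\<^sup>2) / b * z + d) \<in> solution_family b"
    using assms(5)
  proof (elim disjE)
    assume "p = 0"
    then show ?thesis unfolding solution_family_def by auto
  next
    assume "p = 1"
    then show ?thesis unfolding solution_family_def by auto
  next
    assume "p = - 2"
    then have "(\<lambda>z. (1 - p\<^sup>2) / b * z + d) = (\<lambda>z. - (3 / b) * z + d)" by simp
    then show ?thesis unfolding solution_family_def by blast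
  qed
  then show ?thesis by (rule listed_onI) (use d in auto)
qed

text \<open>The sign of \<open>C\<close> and the position of \<open>q\<close> relative to - 1 and 1
  single out one explicit root; injectivity of the cubic on that branch identifies \<open>q\<close>
  with it, and the primitive then identifies \<open>v\<close>.\<close>

lemma listed_on_nonconstant_lift:
  assumes "b \<noteq> 0" "open_interval K" "lifts b K v q" "C \<noteq> 0"
    and root: "\<And>z. z \<in> K \<Longrightarrow> cubic (q z) = C * exp (3 * z / 2)"
  shows "listed_on b K v"
proof -
  have K: "open K" "is_interval K" using assms(2) by (auto simp: open_interval_def)
  have cont: "continuous_on K q" and ne: "\<And>z. z \<in> K \<Longrightarrow> q z \<noteq> - 1"
    using assms(3) by (auto simp: lifts_def)
  have ne': "q z \<noteq> 1" "q z \<noteq> - 2" if "z \<in> K" for z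
    using root[OF that] \<open>C \<noteq> 0\<close> by (auto simp: cubic_factor)
  have "(v has_real_derivative (1 - (q z)\<^sup>2) / b) (at z)" if "z \<in> K" for z
    using assms(3) that unfolding lifts_def by blast
  moreover have "((\<lambda>z. potential (q z) / b) has_real_derivative (1 - (q z)\<^sup>2) / b) (at z)"
    if "z \<in> K" for z
    using potential_flow[OF cubic_root_DERIV[OF K(1) cont \<open>C \<noteq> 0\<close> that root ne[OF that]] ne[OF that] ne'(2)[OF that], of b 0]
    by simp
  ultimately have "\<exists>d. \<forall>z\<in>K. v z = potential (q z) / b + d"
    by (rule DERIV_eq_imp_const_diff[OF assms(2)])
  then obtain d where d: "\<And>z. z \<in> K \<Longrightarrow> v z = potential (q z) / b + d" by blast
  show ?thesis
  proof (cases "C < 0")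
    case True
    then have c: "- C > 0" by simp
    have "q z = q_b (- C) z" if "z \<in> K" for z
    proof (rule cubic_inj_on_branches)
      show "cubic (q z) = cubic (q_b (- C) z)" using root[OF that] cubic_q_b(1)[OF c, of z] by simp
      \<comment> \<open>A negative cubic occurs only below - 2, so there is a single branch.\<close>
      have "(q z - 1)\<^sup>2 * (q z + 2) < 0"
        using root[OF that] True unfolding cubic_factor by (simp add: mult_less_0_iff)
      then have "q z < - 2" by (auto simp: mult_less_0_iff)
      then show "1 < q z \<and> 1 < q_b (- C) z \<or> q z < - 1 \<and> q_b (- C) z < - 1 \<or>
          \<bar>q z\<bar> < 1 \<and> \<bar>q_b (- C) z\<bar> < 1"
        using cubic_q_b(2)[OF c, of z] by simp
    qed
    then have "v z = v_b b (- C) (d - 2 / b) z" if "z \<in> K" for z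
      using d[OF that] that by (simp add: v_b_eq[OF c assms(1)])
    moreover have "(UNIV, v_b b (- C) (d - 2 / b)) \<in> solution_family b"
      using c unfolding solution_family_def by blast
    ultimately show ?thesis by (intro listed_onI) auto
  next
    case False
    then have C: "C > 0" and c: "- C < 0" "- C \<noteq> 0" using \<open>C \<noteq> 0\<close> by auto
    \<comment> \<open>Absorbs the constant by which the trigonometric formulas differ from
      \<open>potential (q z) / b\<close>.\<close>
    define d' where "d' = d - (2 + 8 / 3 * ln 4 - 2 / 3 * ln \<bar>- C\<bar>) / b"
    have below: "z < z_crit (- C)" if "z \<in> K" "q z < 1" for z
    proof -
      \<comment> \<open>This product is \<open>cubic (q z) - 4\<close>.\<close>
      have "(q z + 1)\<^sup>2 * (q z - 2) < 0"
        using ne[OF that(1)] that(2) by (intro mult_pos_neg) auto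
      then have "cubic (q z) < 4"
        by (simp add: cubic_def power2_eq_square power3_eq_cube algebra_simps)
      then show ?thesis using root[OF that(1)] C le_z_crit_iff(2)[OF c(2), of z] by simp
    qed
    have root': "cubic (q z) = \<bar>- C\<bar> * exp (3 * z / 2)" if "z \<in> K" for z
      using root[OF that] C by simp
    have "(\<forall>z\<in>K. q z < - 1) \<or> (\<forall>z\<in>K. - 1 < q z)"
      "(\<forall>z\<in>K. q z < 1) \<or> (\<forall>z\<in>K. 1 < q z)"
      by (rule continuous_avoids[OF K(2) cont]; fact ne ne')+
    then consider "\<forall>z\<in>K. q z < - 1" | "\<forall>z\<in>K. - 1 < q z" "\<forall>z\<in>K. q z < 1" | "\<forall>z\<in>K. 1 < q z"
      by blast
    then show ?thesis
    proof cases
      case 1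
      have b: "z < z_crit (- C)" if "z \<in> K" for z using 1 below[OF that] that by force
      have "q z = q_1 (- C) z" if "z \<in> K" for z
      proof (rule cubic_inj_on_branches)
        have zc: "z \<le> z_crit (- C)" using b[OF that] by simp
        show "cubic (q z) = cubic (q_1 (- C) z)"
          using root'[OF that] cubic_q_1(1)[OF c(2) zc] by (simp only:)
        show "1 < q z \<and> 1 < q_1 (- C) z \<or> q z < - 1 \<and> q_1 (- C) z < - 1 \<or>
            \<bar>q z\<bar> < 1 \<and> \<bar>q_1 (- C) z\<bar> < 1"
          using 1 that cubic_q_1(4)[OF c(2) zc b[OF that]] by simp
      qed
      then have "v z = v_1 b (- C) d' z" if "z \<in> K" for z
        using d[OF that] that v_1_eq[OF c(2) assms(1) less_imp_le[OF b[OF that]], of d']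
        by (simp add: d'_def)
      moreover have "({..< z_crit (- C)}, v_1 b (- C) d') \<in> solution_family b"
        using c(1) unfolding solution_family_def by blast
      ultimately show ?thesis using b by (intro listed_onI) auto
    next
      case 2
      have b: "z < z_crit (- C)" if "z \<in> K" for z using 2(2) below[OF that] that by blast
      have "q z = q_2 (- C) z" if "z \<in> K" for z
      proof (rule cubic_inj_on_branches)
        have zc: "z \<le> z_crit (- C)" using b[OF that] by simp
        show "cubic (q z) = cubic (q_2 (- C) z)"
          using root'[OF that] cubic_q_2(1)[OF c(2) zc] by (simp only:)
        show "1 < q z \<and> 1 < q_2 (- C) z \<or> q z < - 1 \<and> q_2 (- C) z < - 1 \<or>
            \<bar>q z\<bar> < 1 \<and> \<bar>q_2 (- C) z\<bar> < 1"
          using 2(1)[rule_format, OF that] 2(2)[rule_format, OF that]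
            cubic_q_2(4)[OF c(2) zc b[OF that]] cubic_q_2(3)[OF c(2) zc]
          by (simp add: abs_less_iff)
      qed
      then have "v z = v_2 b (- C) d' z" if "z \<in> K" for z
        using d[OF that] that v_2_eq[OF c(2) assms(1) less_imp_le[OF b[OF that]], of d']
        by (simp add: d'_def)
      moreover have "({..< z_crit (- C)}, v_2 b (- C) d') \<in> solution_family b"
        using c(1) unfolding solution_family_def by blast
      ultimately show ?thesis using b by (intro listed_onI) auto
    next
      case 3
      have "q z = q_3 (- C) z" if "z \<in> K" for z
      proof (rule cubic_inj_on_branches)
        show "cubic (q z) = cubic (q_3 (- C) z)"
          using root'[OF that] cubic_q_3(1)[OF c(2), of z] by (simp only:)
        show "1 < q z \<and> 1 < q_3 (- C) z \<or> q z < - 1 \<and> q_3 (- C) z < - 1 \<or>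
            \<bar>q z\<bar> < 1 \<and> \<bar>q_3 (- C) z\<bar> < 1"
          using 3 that cubic_q_3(2)[OF c(2), of z] by simp
      qed
      then have "v z = v_3 b (- C) d' z" if "z \<in> K" for z
        using d[OF that] that v_3_eq[OF c(2) assms(1), of d' z] by (simp add: d'_def)
      moreover have "(UNIV, v_3 b (- C) d') \<in> solution_family b"
        using c(1) unfolding solution_family_def by blast
      ultimately show ?thesis by (intro listed_onI) auto
    qed
  qed
qed

text \<open>For \<open>C = 0\<close> the cubic leaves only the values 1 and - 2. The forbidden value
  - 1 separates them, so one of them is taken throughout and \<open>v\<close> is a line.\<close>

lemma listed_on_isolated_zeros:
  assumes "b \<noteq> 0" "open_interval K" "lifts b K v q" "finite {z \<in> K. q z = 0}"
  shows "listed_on b K v"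
proof -
  obtain C where root: "\<And>z. z \<in> K \<Longrightarrow> cubic (q z) = C * exp (3 * z / 2)"
    using first_integral[OF assms(3,2,4)] by blast
  show ?thesis
  proof (cases "C = 0")
    case True
    then have two: "q z = 1 \<or> q z = - 2" if "z \<in> K" for z
      using root[OF that] by (auto simp: cubic_factor)
    have "is_interval K" "continuous_on K q" "\<And>z. z \<in> K \<Longrightarrow> q z \<noteq> - 1"
      using assms(2,3) by (auto simp: open_interval_def lifts_def)
    then have "(\<forall>z\<in>K. q z < - 1) \<or> (\<forall>z\<in>K. - 1 < q z)" by (rule continuous_avoids)
    then show ?thesis
    proof
      assume "\<forall>z\<in>K. q z < - 1"
      then show ?thesis using two
        by (intro listed_on_constant_lift[OF assms(1-3), of "- 2"]) force+
    next
      assume "\<forall>z\<in>K. - 1 < q z"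
      then show ?thesis using two
        by (intro listed_on_constant_lift[OF assms(1-3), of 1]) force+
    qed
  qed (rule listed_on_nonconstant_lift[OF assms(1-3) _ root])
qed

lemma three_times_differentiable_listed:
  assumes "b \<noteq> 0" "open_interval I" "solves_ode2 b I v"
    and "\<forall>z\<in>I. deriv (deriv v) differentiable (at z)"
  shows "listed_on b I v"
proof -
  obtain q where q: "lifts b I v q" using solves_ode2_lifts[OF assms(1-3)] by blast
  have "(\<forall>z\<in>I. q z = 0) \<or> finite {z \<in> I. q z = 0}"
    using assms(4) by (intro lifts_zeros_dichotomy[OF assms(1,2) q]) auto
  then show ?thesis
    using listed_on_constant_lift[OF assms(1,2) q, of 0] listed_on_isolated_zeros[OF assms(1,2) q]
    by blast
qed

text \<open>\<open>S\<close> consists of the least and the greatest zero of \<open>q\<close>, as far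
  as they exist. An interval avoiding them cannot contain both a zero and a nonzero value: the last
  zero before the nonzero value would be an end of the zero set.\<close>

lemma piecewise_listed:
  assumes "b \<noteq> 0" "open_interval I" "solves_ode2 b I v"
  shows "\<exists>S. finite S \<and> S \<subseteq> {z \<in> I. deriv v z = 1 / b} \<and>
    (\<forall>K. open_interval K \<and> K \<subseteq> I - S \<longrightarrow> listed_on b K v)"
proof -
  have I: "is_interval I" using assms(2) by (simp add: open_interval_def)
  obtain q where q: "lifts b I v q" using solves_ode2_lifts[OF assms] by blast
  define Z where "Z = {z \<in> I. q z = 0}"
  define L where "L = {t \<in> Z. \<forall>y\<in>Z. t \<le> y}"
  define R where "R = {t \<in> Z. \<forall>y\<in>Z. y \<le> t}"
  have "finite L"
  proof (cases "L = {}")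
    case False
    then obtain t where "t \<in> L" by blast
    then have "L \<subseteq> {t}" by (auto simp: L_def intro: antisym)
    then show ?thesis by (rule finite_subset) simp
  qed simp
  moreover have "finite R"
  proof (cases "R = {}")
    case False
    then obtain t where "t \<in> R" by blast
    then have "R \<subseteq> {t}" by (auto simp: R_def intro: antisym)
    then show ?thesis by (rule finite_subset) simp
  qed simp
  ultimately have "finite (L \<union> R)" by simp
  moreover have "L \<union> R \<subseteq> {z \<in> I. deriv v z = 1 / b}"
  proof
    fix z assume "z \<in> L \<union> R"
    then have z: "z \<in> I" "q z = 0" by (auto simp: L_def R_def Z_def)
    then have "(v has_real_derivative (1 - 0\<^sup>2) / b) (at z)" using q unfolding lifts_def by metis
    then have "deriv v z = 1 / b" using DERIV_imp_deriv by fastforce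
    then show "z \<in> {z \<in> I. deriv v z = 1 / b}" using z by simp
  qed
  moreover have "listed_on b K v" if K: "open_interval K" "K \<subseteq> I - (L \<union> R)" for K
  proof -
    have qK: "lifts b K v q" using K(2) by (intro lifts_subset[OF q]) auto
    have Ki: "is_interval K" using K(1) by (simp add: open_interval_def)
    have "(\<forall>z\<in>K. q z = 0) \<or> {z \<in> K. q z = 0} = {}"
    proof (rule ccontr)
      assume "\<not> ?thesis"
      then obtain a c where ac: "a \<in> K" "q a = 0" "c \<in> K" "q c \<noteq> 0" by blast
      from lifts_zero_edge[OF qK Ki ac(1,3,2,4)]
      obtain t where t: "t \<in> closed_segment a c" "q t = 0" "t \<noteq> c"
        "\<And>x. x \<in> closed_segment t c \<Longrightarrow> q x = 0 \<Longrightarrow> x = t" by blast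
      have tK: "t \<in> K" using closed_segment_subset_interval[OF Ki ac(1,3)] t(1) by blast
      then have tZ: "t \<in> Z" using K(2) t(2) by (auto simp: Z_def)
      have cI: "c \<in> I" using ac(3) K(2) by auto
      \<comment> \<open>Convexity of the zero set: zeros cannot lie on both sides of
        \<open>c\<close>, so the zero \<open>t\<close> nearest to \<open>c\<close> is
        extremal.\<close>
      have cx: "\<not> (x \<le> c \<and> c \<le> y)" if "x \<in> Z" "y \<in> Z" for x y
        using lifts_zeros_convex[OF q I, of x y c] that ac(4) by (auto simp: Z_def)
      have "t \<in> L \<union> R"
      proof (cases "t < c")
        case True
        have "y \<le> t" if "y \<in> Z" for y
        proof (rule ccontr)
          assume "\<not> y \<le> t"
          moreover have "y < c" using cx[OF tZ that] True by simp
          ultimately have "y = t"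
            using that True by (intro t(4)) (auto simp: Z_def closed_segment_eq_real_ivl)
          then show False using \<open>\<not> y \<le> t\<close> by simp
        qed
        then show ?thesis using tZ by (simp add: R_def)
      next
        case False
        then have "c < t" using t(3) by simp
        have "t \<le> y" if "y \<in> Z" for y
        proof (rule ccontr)
          assume "\<not> t \<le> y"
          moreover have "c < y" using cx[OF that tZ] \<open>c < t\<close> by simp
          ultimately have "y = t"
            using that \<open>c < t\<close> by (intro t(4)) (auto simp: Z_def closed_segment_eq_real_ivl)
          then show False using \<open>\<not> t \<le> y\<close> by simp
        qed
        then show ?thesis using tZ by (simp add: L_def)
      qed
      then show False using tK K(2) by blast
    qed
    then show ?thesis
    proof
      assume "\<forall>z\<in>K. q z = 0"
      then show ?thesis by (intro listed_on_constant_lift[OF assms(1) K(1) qK, of 0]) auto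
    next
      assume "{z \<in> K. q z = 0} = {}"
      then have "finite {z \<in> K. q z = 0}" by (simp only: finite.emptyI)
      then show ?thesis by (rule listed_on_isolated_zeros[OF assms(1) K(1) qK])
    qed
  qed
  ultimately show ?thesis by blast
qed

lemma solution_family_solves:
  assumes "b \<noteq> 0" "(J, f) \<in> solution_family b"
  shows "solves_ode2 b J f"
proof -
  have p: "flow_pair b J f" by (rule solution_family_flow[OF assms])
  then have "open J" by (simp add: flow_pair_def)
  then show ?thesis using flow_pair_solves[OF assms(1) p, of J f] by simp
qed

theorem theorem4p2:
  fixes b :: real
  shows
    "(b \<noteq> 0 \<longrightarrow>
       (\<forall>(J, f) \<in> solution_family b. solves_ode2 b J f) \<and>
       (\<forall>I v. open_interval I \<longrightarrow>
          (solves_ode2 b I v \<and> (\<forall>z\<in>I. deriv (deriv v) differentiable (at z))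
             \<longleftrightarrow> listed_on b I v)) \<and>
       (\<forall>I v. open_interval I \<and> solves_ode2 b I v \<longrightarrow>
          (\<exists>S. finite S \<and> S \<subseteq> {z \<in> I. deriv v z = 1 / b} \<and>
             (\<forall>K. open_interval K \<and> K \<subseteq> I - S \<longrightarrow> listed_on b K v))) \<and>
       (\<forall>c > 0. dom_b c = UNIV) \<and>
       (\<forall>c < 0. dom_1 c = {..z_crit c} \<and> dom_2 c = {..z_crit c} \<and>
          dom_31 c = {..z_crit c} \<and> dom_32 c = {z_crit c..} \<and>
          (\<forall>d. v_1 b c d (z_crit c) = v_2 b c d (z_crit c))) \<and>
       (\<forall>I y. open_interval I \<longrightarrow>
          (exceptional_solution b I y \<longleftrightarrow> (\<forall>z\<in>I. y z = 1 / b))) \<and>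
       (\<forall>I v. open_interval I \<and> (\<forall>z\<in>I. v differentiable (at z)) \<longrightarrow>
          (exceptional_solution b I (deriv v) \<longleftrightarrow> (\<exists>d. \<forall>z\<in>I. v z = 1 / b * z + d)))) \<and>
     (b = 0 \<longrightarrow>
       linear (\<lambda>(p, q). ode_lhs b p q) \<and>
       (\<forall>I v. open_interval I \<longrightarrow>
          (solves_ode2 b I v \<longleftrightarrow>
             (\<exists>d1 d2. \<forall>z\<in>I. v z = d1 + d2 * exp (3 * z / 4)))))"
proof (cases "b = 0")
  case True
  show ?thesis unfolding True using linear_ode_lhs linear_ode_iff by blast
next
  case False
  have op: "open I" if "open_interval I" for I using that by (simp add: open_interval_def)
  have "\<forall>(J, f) \<in> solution_family b. solves_ode2 b J f"
    using solution_family_solves[OF False] by blast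
  moreover have "\<forall>I v. open_interval I \<longrightarrow>
      (solves_ode2 b I v \<and> (\<forall>z\<in>I. deriv (deriv v) differentiable (at z)) \<longleftrightarrow> listed_on b I v)"
    using three_times_differentiable_listed[OF False] listed_on_solves[OF False op] by blast
  moreover have "\<forall>I v. open_interval I \<and> solves_ode2 b I v \<longrightarrow>
      (\<exists>S. finite S \<and> S \<subseteq> {z \<in> I. deriv v z = 1 / b} \<and>
        (\<forall>K. open_interval K \<and> K \<subseteq> I - S \<longrightarrow> listed_on b K v))"
    using piecewise_listed[OF False] by blast
  moreover have "\<forall>c > 0. dom_b c = UNIV" using dom_b_eq by blast
  moreover have "\<forall>c < 0. dom_1 c = {..z_crit c} \<and> dom_2 c = {..z_crit c} \<and>
      dom_31 c = {..z_crit c} \<and> dom_32 c = {z_crit c..} \<and>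
      (\<forall>d. v_1 b c d (z_crit c) = v_2 b c d (z_crit c))"
    by (simp add: dom_1_eq dom_2_eq dom_31_eq dom_32_eq v_1_v_2_z_crit)
  moreover have "\<forall>I y. open_interval I \<longrightarrow>
      (exceptional_solution b I y \<longleftrightarrow> (\<forall>z\<in>I. y z = 1 / b))"
    using exceptional_solution_iff[OF False op] by blast
  moreover have "\<forall>I v. open_interval I \<and> (\<forall>z\<in>I. v differentiable (at z)) \<longrightarrow>
      (exceptional_solution b I (deriv v) \<longleftrightarrow> (\<exists>d. \<forall>z\<in>I. v z = 1 / b * z + d))"
    using exceptional_solution_iff[OF False op] deriv_const_iff by simp
  ultimately show ?thesis using False by blast
qed

end
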